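(* There exists a single-pass data stream algorithm using $O(1)$ words of working memory that, given $k$ and $\epsilon\in(0,1)$, processes a stream of $O(k\epsilon^{-2}\log^2 k\,\log^2(1/\epsilon))$ i.i.d. samples from an unknown distribution $\mathcal D$ on $[k]=\{1,\dots,k\}$ and returns an additive $\epsilon$ approximation of $H(\mathcal D)$ (i.e., a number $\hat H$ with $|\hat H-H(\mathcal D)|\le\epsilon$) with probability at least $2/3$.
   Context: For a distribution $\mathcal D$ on $[k]$ with probabilities $p_1,\dots,p_k$, its (Shannon) entropy is $H(\mathcal D)=\sum_{i=1}^k p_i\log(1/p_i)$, with logarithms base $2$. A "word" of memory is a unit holding $\Theta(\log(k/\epsilon))$ bits (enough to store the name of an element of $[k]$ and the value of $\epsilon$).
   Formalization: The factor log²(1/ε) in the number of samples is read as max(1, log(1/ε))²; read literally, the bound tends to zero samples as ε tends to 1, where the claim fails (e.g. k = 16, with entropies 0 and 4). For ε ≤ 1/2 the bound is unchanged. *)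

theory Defs
  imports "HOL-Probability.Probability"
begin

definition shannon_entropy :: "nat \<Rightarrow> nat pmf \<Rightarrow> real" where
  "shannon_entropy k D = (\<Sum>i = 1..k. pmf D i * log 2 (1 / pmf D i))"

text \<open>
  A data stream algorithm is one fixed program for a word machine with \<open>q\<close> registers of
  \<open>w\<close> bits each. There is no other memory and no indirect addressing, so apart from its
  position in the (fixed) program everything such a program remembers is held in \<open>q\<close> words.
  The operands of \<^term>\<open>Op\<close>, \<^term>\<open>IfLess\<close> and \<^term>\<open>WhileLess\<close> are registers.
\<close>

datatype aop = Add | Sub | Mul | Quot

datatype com =
    Skip
  | Const nat nat
  | Op nat aop nat nat
  | Read nat
  | Flip nat
  | Seq com com
  | IfLess nat nat com com
  | WhileLess nat nat com

fun aop_val :: "aop \<Rightarrow> nat \<Rightarrow> nat \<Rightarrow> nat" where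
  "aop_val Add a b = a + b"
| "aop_val Sub a b = a - b"
| "aop_val Mul a b = a * b"
| "aop_val Quot a b = a div b"

text \<open>
  Every write to a register is truncated to \<open>w\<close> bits. Only the registers \<open>0, \<dots>, q - 1\<close>
  exist: writes to any other index are lost, and (as all registers start at 0) such an index
  always reads as 0.
\<close>

definition store :: "nat \<Rightarrow> nat \<Rightarrow> nat \<Rightarrow> nat \<Rightarrow> (nat \<Rightarrow> nat) \<Rightarrow> (nat \<Rightarrow> nat)" where
  "store q w x v R = (if x < q then R(x := v mod 2 ^ w) else R)"

text \<open>
  Big-step semantics. A configuration consists of the registers, the unread part of the
  stream, and the unused random bits. A stream item is gone once it has been read (single
  pass). Stream items are elements of \<open>{1..k}\<close>, so \<^term>\<open>Read\<close> can report the end of the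
  stream by 0. The semantics is deterministic; a run that diverges or that asks for more
  random bits than supplied has no final configuration.
\<close>

type_synonym config = "(nat \<Rightarrow> nat) \<times> nat list \<times> bool list"

inductive exec :: "nat \<Rightarrow> nat \<Rightarrow> com \<Rightarrow> config \<Rightarrow> config \<Rightarrow> bool" for q w :: nat where
  Skip: "exec q w Skip s s"
| Const: "exec q w (Const x v) (R, xs, bs) (store q w x v R, xs, bs)"
| Op: "exec q w (Op x f y z) (R, xs, bs) (store q w x (aop_val f (R y) (R z)) R, xs, bs)"
| Read: "exec q w (Read x) (R, a # xs, bs) (store q w x a R, xs, bs)"
| ReadEnd: "exec q w (Read x) (R, [], bs) (store q w x 0 R, [], bs)"
| Flip: "exec q w (Flip x) (R, xs, b # bs) (store q w x (of_bool b) R, xs, bs)"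
| Seq: "exec q w c1 s s' \<Longrightarrow> exec q w c2 s' s'' \<Longrightarrow> exec q w (Seq c1 c2) s s''"
| IfTrue: "fst s y < fst s z \<Longrightarrow> exec q w c1 s s' \<Longrightarrow> exec q w (IfLess y z c1 c2) s s'"
| IfFalse: "\<not> fst s y < fst s z \<Longrightarrow> exec q w c2 s s' \<Longrightarrow> exec q w (IfLess y z c1 c2) s s'"
| WhileTrue: "fst s y < fst s z \<Longrightarrow> exec q w c s s' \<Longrightarrow>
    exec q w (WhileLess y z c) s' s'' \<Longrightarrow> exec q w (WhileLess y z c) s s''"
| WhileFalse: "\<not> fst s y < fst s z \<Longrightarrow> exec q w (WhileLess y z c) s s"

text \<open>
  The parameters are passed in registers 0 and 1. As a word cannot hold an arbitrary real,
  \<open>\<epsilon>\<close> is passed as the integer \<open>\<lceil>1 / \<epsilon>\<rceil>\<close>, that is, rounded down to a unit fraction (by a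
  factor of at most 2).
\<close>

definition init_regs :: "nat \<Rightarrow> nat \<Rightarrow> nat \<Rightarrow> real \<Rightarrow> (nat \<Rightarrow> nat)" where
  "init_regs q w k \<epsilon> = store q w 1 (nat \<lceil>1 / \<epsilon>\<rceil>) (store q w 0 k (\<lambda>_. 0))"

text \<open>The result is the fraction whose numerator and denominator are left in registers 0 and 1.\<close>

definition returns ::
  "nat \<Rightarrow> nat \<Rightarrow> com \<Rightarrow> nat \<Rightarrow> real \<Rightarrow> nat list \<Rightarrow> bool list \<Rightarrow> real \<Rightarrow> bool" where
  "returns q w P k \<epsilon> xs bs h \<longleftrightarrow>
    (\<exists>R xs' bs'. exec q w P (init_regs q w k \<epsilon>, xs, bs) (R, xs', bs') \<and>
      h = real (R 0) / real (R 1))"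

text \<open>A word has \<open>\<Theta>(log (k / \<epsilon>))\<close> bits; \<open>c\<close> is the constant hidden in the \<open>\<Theta>\<close>.\<close>

definition word_bits :: "nat \<Rightarrow> nat \<Rightarrow> real \<Rightarrow> nat" where
  "word_bits c k \<epsilon> = c * nat \<lceil>log 2 (real k / \<epsilon>)\<rceil>"

end

(*
  Read a sample i from the stream and let T be the number of further samples read before the
  next occurrence of i. Given i, T is geometric with parameter p_i, and since
  E (harm T) = (sum over j >= 1 of P (T >= j) / j) = - ln p_i, the harmonic number harm T is an
  exactly unbiased estimator of the entropy in nats. Moreover E T <= k because the factors p_i
  cancel, and E (harm T)^2 = O(log^2 k) because harm T is logarithmic in T.
  Averaging over M = O(log^2 k / epsilon^2) repetitions, Chebyshev's inequality bounds the
  estimation error and Markov's inequality the number of samples used.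
  The conversion from nats to bits needs ln 2 up to an error of order epsilon / k, which the
  program obtains as the sum of 1 / j over N < j <= 2 N, in the same fixed-point arithmetic.
*)

theory Submission
  imports Defs "HOL-Library.Log_Nat"
begin

section \<open>Gaps between equal samples\<close>

text \<open>The estimator stops at a random time, but the stream has a fixed length. A list-level
  model of the program, \<open>gaps\<close>, reconciles the two: on a finite i.i.d. stream its law
  is exactly that of independent gaps, cut off when they use more than \<open>n\<close> samples.
  Probability enters only there; what remains is a deterministic claim about each good stream. That
  claim is shaped by the machine. Registers hold integers modulo \<open>2 ^ w\<close>, so every loop
  proof carries an overflow budget, and reciprocals become quotients of a unit
  \<open>S = N * N\<close> with \<open>N = 100 * k * E\<close>, where \<open>E\<close> is 1 /
  epsilon rounded up. The square makes the error of the ln 2 sum, of order \<open>N\<close>, a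
  fraction 1 / N of the unit. The factor \<open>k\<close> in \<open>N\<close> pays for rounding O(M
  k) quotients and for the crude bound O(k) on the entropy that multiplies the ln 2 error.\<close>

fun wait :: "nat \<Rightarrow> nat list \<Rightarrow> (nat \<times> nat list) option" where
  "wait i [] = None"
| "wait i (x # xs) = (if x = i then Some (0, xs) else map_option (apfst Suc) (wait i xs))"

text \<open>A model of the two nested sampling loops. \<open>None\<close> records that the stream
  ran out before \<open>m\<close> gaps were complete, the event that Markov's inequality has to
  exclude.\<close>

primrec gaps :: "nat \<Rightarrow> nat list \<Rightarrow> nat list option" where
  "gaps 0 xs = Some []"
| "gaps (Suc m) xs = (case xs of [] \<Rightarrow> None | x # ys \<Rightarrow>
     (case wait x ys of None \<Rightarrow> None | Some (t, zs) \<Rightarrow> map_option (Cons t) (gaps m zs)))"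

text \<open>\<open>geometric_pmf\<close> counts the failures before the first success, so a gap may
  be 0; its parameter is positive for every \<open>i\<close> that \<open>D\<close> can
  produce.\<close>

definition gap_pmf :: "nat pmf \<Rightarrow> nat pmf" where
  "gap_pmf D = bind_pmf D (\<lambda>i. geometric_pmf (pmf D i))"

text \<open>While \<open>i\<close> is awaited, a draw matters only as hit or miss. This identifies
  it with the coin in the recursion of the geometric distribution.\<close>

lemma bernoulli_pmf_eq_map: "bernoulli_pmf (pmf D i) = map_pmf (\<lambda>x. x = i) D"
proof (rule pmf_eqI)
  fix b
  have "(\<lambda>x. x = i) -` {True} = {i}" "(\<lambda>x. x = i) -` {False} = - {i}" by auto
  then show "pmf (bernoulli_pmf (pmf D i)) b = pmf (map_pmf (\<lambda>x. x = i) D) b"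
    by (cases b) (simp_all add: pmf_map pmf_le_1 measure_pmf.prob_compl[of "{i}", simplified, folded Compl_eq_Diff_UNIV] measure_pmf_single)
qed

text \<open>A strong Markov property: after a hit at time \<open>t\<close>, the unread
  \<open>n - Suc t\<close> samples are i.i.d. again. Induction on \<open>n\<close> matches the first
  draw, hit or miss, with the recursion of the geometric law.\<close>

lemma map_wait_replicate_pmf:
  assumes "i \<in> set_pmf D"
  shows "map_pmf (wait i) (replicate_pmf n D) =
    do {t \<leftarrow> geometric_pmf (pmf D i);
        if t < n then map_pmf (\<lambda>xs. Some (t, xs)) (replicate_pmf (n - Suc t) D)
        else return_pmf None}"
proof (induction n)
  case 0
  show ?case by simp
next
  case (Suc n)
  let ?G = "geometric_pmf (pmf D i)"
  let ?F = "\<lambda>n t. if t < n then map_pmf (\<lambda>xs. Some (t, xs)) (replicate_pmf (n - Suc t) D)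
        else return_pmf None"
  have p: "pmf D i \<in> {0<..1}" using assms by (simp add: pmf_positive pmf_le_1)
  have "map_pmf (wait i) (replicate_pmf (Suc n) D) =
    bind_pmf D (\<lambda>x. map_pmf (\<lambda>xs. wait i (x # xs)) (replicate_pmf n D))"
    by (simp add: map_pmf_def bind_assoc_pmf bind_return_pmf)
  also have "\<dots> = bind_pmf D (\<lambda>x. if x = i then ?F (Suc n) 0 else bind_pmf ?G (\<lambda>t. ?F (Suc n) (Suc t)))"
  proof (intro bind_pmf_cong refl)
    fix x
    have "map_pmf (\<lambda>xs. map_option (apfst Suc) (wait i xs)) (replicate_pmf n D) =
      map_pmf (map_option (apfst Suc)) (map_pmf (wait i) (replicate_pmf n D))"
      by (simp add: pmf.map_comp o_def)
    also have "\<dots> = bind_pmf ?G (\<lambda>t. map_pmf (map_option (apfst Suc)) (?F n t))"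
      unfolding Suc by (simp add: map_bind_pmf)
    also have "\<dots> = bind_pmf ?G (\<lambda>t. ?F (Suc n) (Suc t))"
      by (intro bind_pmf_cong refl) (simp add: pmf.map_comp o_def)
    finally show "map_pmf (\<lambda>xs. wait i (x # xs)) (replicate_pmf n D) =
      (if x = i then ?F (Suc n) 0 else bind_pmf ?G (\<lambda>t. ?F (Suc n) (Suc t)))" by simp
  qed
  also have "\<dots> = bind_pmf (bernoulli_pmf (pmf D i))
      (\<lambda>b. if b then ?F (Suc n) 0 else bind_pmf ?G (\<lambda>t. ?F (Suc n) (Suc t)))"
    unfolding bernoulli_pmf_eq_map by (simp add: bind_map_pmf)
  also have "\<dots> = bind_pmf (bernoulli_pmf (pmf D i))
      (\<lambda>b. bind_pmf (if b then return_pmf 0 else map_pmf Suc ?G) (?F (Suc n)))"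
    by (intro bind_pmf_cong refl) (simp add: bind_return_pmf bind_map_pmf)
  also have "\<dots> = bind_pmf ?G (?F (Suc n))"
    by (subst (2) geometric_bind_pmf_unfold[OF p]) (simp add: bind_assoc_pmf)
  finally show ?case .
qed

text \<open>The summand \<open>2 * m\<close> counts, for each gap, the draw of the awaited element
  and the draw that hits it; only the misses enter \<open>ts\<close>. The Markov property of
  \<open>wait\<close> makes the gaps independent.\<close>

lemma map_gaps_replicate_pmf:
  "map_pmf (gaps m) (replicate_pmf n D) =
   map_pmf (\<lambda>ts. if sum_list ts + 2 * m \<le> n then Some ts else None) (replicate_pmf m (gap_pmf D))"
proof (induction m arbitrary: n)
  case 0
  show ?case by (simp add: map_pmf_const)
next
  case (Suc m)
  let ?R = "replicate_pmf m (gap_pmf D)"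
  show ?case
  proof (cases n)
    case 0
    then show ?thesis by (simp add: map_pmf_const)
  next
    case n: (Suc n')
    let ?cont = "\<lambda>r. case r of None \<Rightarrow> None | Some (t, zs) \<Rightarrow> map_option (Cons t) (gaps m zs)"
    have "map_pmf (gaps (Suc m)) (replicate_pmf n D) =
      bind_pmf D (\<lambda>x. map_pmf ?cont (map_pmf (wait x) (replicate_pmf n' D)))"
      by (simp add: n map_pmf_def bind_assoc_pmf bind_return_pmf)
    also have "\<dots> = bind_pmf D (\<lambda>x. bind_pmf (geometric_pmf (pmf D x)) (\<lambda>t.
       map_pmf (\<lambda>ts. if sum_list (t # ts) + 2 * Suc m \<le> n then Some (t # ts) else None) ?R))"
    proof (intro bind_pmf_cong refl)
      fix x assume x: "x \<in> set_pmf D"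
      show "map_pmf ?cont (map_pmf (wait x) (replicate_pmf n' D)) =
        bind_pmf (geometric_pmf (pmf D x)) (\<lambda>t.
       map_pmf (\<lambda>ts. if sum_list (t # ts) + 2 * Suc m \<le> n then Some (t # ts) else None) ?R)"
        unfolding map_wait_replicate_pmf[OF x] map_bind_pmf
      proof (intro bind_pmf_cong refl)
        fix t
        show "map_pmf ?cont (if t < n' then map_pmf (\<lambda>xs. Some (t, xs)) (replicate_pmf (n' - Suc t) D)
             else return_pmf None) =
          map_pmf (\<lambda>ts. if sum_list (t # ts) + 2 * Suc m \<le> n then Some (t # ts) else None) ?R"
        proof (cases "t < n'")
          case True
          have "map_pmf (\<lambda>xs. map_option (Cons t) (gaps m xs)) (replicate_pmf (n' - Suc t) D) =
            map_pmf (map_option (Cons t)) (map_pmf (gaps m) (replicate_pmf (n' - Suc t) D))"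
            by (simp add: pmf.map_comp o_def)
          also have "\<dots> = map_pmf (\<lambda>ts. if sum_list (t # ts) + 2 * Suc m \<le> n then Some (t # ts) else None) ?R"
            unfolding Suc using True n
            by (auto simp: pmf.map_comp o_def intro!: map_pmf_cong)
          finally show ?thesis using True by (simp add: pmf.map_comp o_def)
        next
          case False
          then show ?thesis using n by (simp add: map_pmf_const)
        qed
      qed
    qed
    also have "\<dots> = map_pmf (\<lambda>ts. if sum_list ts + 2 * Suc m \<le> n then Some ts else None)
       (replicate_pmf (Suc m) (gap_pmf D))"
      by (simp add: map_pmf_def bind_assoc_pmf bind_return_pmf gap_pmf_def)
    finally show ?thesis .
  qed
qed

section \<open>Sums of independent samples\<close>

text \<open>Everything is nonnegative, so the moment is computed as a nonnegative integral over head
  and tail; its finite value yields integrability and expectation at once. The second moment is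
  treated in the same way.\<close>

lemma expectation_sum_list_replicate_pmf:
  fixes f :: "'a \<Rightarrow> real" and p :: "'a pmf" and m :: nat
  assumes f: "\<And>x. 0 \<le> f x" "integrable p f"
  defines "S \<equiv> \<lambda>xs. sum_list (map f xs)"
  shows "integrable (replicate_pmf m p) S \<and>
    measure_pmf.expectation (replicate_pmf m p) S = real m * measure_pmf.expectation p f"
proof (induction m)
  case 0
  show ?case by (auto simp: S_def intro!: integrable_measure_pmf_finite)
next
  case (Suc m)
  let ?R = "replicate_pmf m p"
  define \<mu> where "\<mu> = measure_pmf.expectation p f"
  have IH: "integrable ?R S" "measure_pmf.expectation ?R S = real m * \<mu>"
    using Suc by (auto simp: \<mu>_def)
  have S0: "0 \<le> S xs" for xs unfolding S_def by (intro sum_list_nonneg) (auto simp: f)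
  have SC: "S (x # xs) = f x + S xs" for x xs by (simp add: S_def)
  have mu0: "0 \<le> \<mu>" unfolding \<mu>_def by (intro integral_nonneg_AE) (simp add: f)
  have "(\<integral>\<^sup>+xs. ennreal (S xs) \<partial>replicate_pmf (Suc m) p) = (\<integral>\<^sup>+x. \<integral>\<^sup>+xs. ennreal (f x + S xs) \<partial>?R \<partial>p)"
    by (simp add: SC)
  also have "\<dots> = (\<integral>\<^sup>+x. ennreal (f x + real m * \<mu>) \<partial>p)"
  proof (intro nn_integral_cong)
    fix x
    have "(\<integral>\<^sup>+xs. ennreal (f x + S xs) \<partial>?R) = ennreal (measure_pmf.expectation ?R (\<lambda>xs. f x + S xs))"
      by (intro nn_integral_eq_integral) (auto simp: IH f S0)
    then show "(\<integral>\<^sup>+xs. ennreal (f x + S xs) \<partial>?R) = ennreal (f x + real m * \<mu>)"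
      using IH by simp
  qed
  also have "\<dots> = ennreal (measure_pmf.expectation p (\<lambda>x. f x + real m * \<mu>))"
    by (intro nn_integral_eq_integral) (auto simp: f mu0)
  also have "\<dots> = ennreal (real (Suc m) * \<mu>)"
    using f by (simp add: \<mu>_def algebra_simps)
  finally have 1: "(\<integral>\<^sup>+xs. ennreal (S xs) \<partial>replicate_pmf (Suc m) p) = ennreal (real (Suc m) * \<mu>)" .
  show ?case
    using 1 mu0 unfolding \<mu>_def[symmetric]
    by (subst (asm) nn_integral_eq_integrable) (auto simp: S0)
qed

text \<open>Expanding the square gives \<open>m\<close> diagonal terms with mean \<open>v\<close>
  and \<open>m * (m - 1)\<close> products of independent factors with mean
  \<open>\<mu>\<^sup>2\<close>.\<close>

lemma second_moment_replicate_pmf: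
  fixes f :: "'a \<Rightarrow> real" and p :: "'a pmf" and m :: nat
  assumes f: "\<And>x. 0 \<le> f x" "integrable p f" "integrable p (\<lambda>x. (f x)\<^sup>2)"
  defines "\<mu> \<equiv> measure_pmf.expectation p f" and "v \<equiv> measure_pmf.expectation p (\<lambda>x. (f x)\<^sup>2)"
  defines "S \<equiv> \<lambda>xs. sum_list (map f xs)"
  shows "integrable (replicate_pmf m p) (\<lambda>xs. (S xs)\<^sup>2) \<and>
    measure_pmf.expectation (replicate_pmf m p) (\<lambda>xs. (S xs)\<^sup>2) = real m * v + real m * (real m - 1) * \<mu>\<^sup>2"
proof (induction m)
  case 0
  show ?case by (auto simp: S_def intro!: integrable_measure_pmf_finite)
next
  case (Suc m)
  let ?R = "replicate_pmf m p"
  let ?G = "real m * v + real m * (real m - 1) * \<mu>\<^sup>2"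
  have E: "integrable ?R S" "measure_pmf.expectation ?R S = real m * \<mu>"
    using expectation_sum_list_replicate_pmf[of f p m] f by (simp_all add: S_def \<mu>_def)
  have IH: "integrable ?R (\<lambda>xs. (S xs)\<^sup>2)" "measure_pmf.expectation ?R (\<lambda>xs. (S xs)\<^sup>2) = ?G"
    using Suc by auto
  have S0: "0 \<le> S xs" for xs unfolding S_def by (intro sum_list_nonneg) (auto simp: f)
  have SC: "S (x # xs) = f x + S xs" for x xs by (simp add: S_def)
  have mu0: "0 \<le> \<mu>" unfolding \<mu>_def by (intro integral_nonneg_AE) (simp add: f)
  have v0: "0 \<le> v" unfolding v_def by (intro integral_nonneg_AE) simp
  have G0: "0 \<le> ?G" unfolding IH(2)[symmetric] by (intro integral_nonneg_AE) simp
  have "(\<integral>\<^sup>+xs. ennreal ((S xs)\<^sup>2) \<partial>replicate_pmf (Suc m) p) =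
     (\<integral>\<^sup>+x. \<integral>\<^sup>+xs. ennreal ((f x)\<^sup>2 + 2 * f x * S xs + (S xs)\<^sup>2) \<partial>?R \<partial>p)"
    by (simp add: SC power2_sum ac_simps)
  also have "\<dots> = (\<integral>\<^sup>+x. ennreal ((f x)\<^sup>2 + f x * (2 * (real m * \<mu>)) + ?G) \<partial>p)"
  proof (intro nn_integral_cong)
    fix x
    have "(\<integral>\<^sup>+xs. ennreal ((f x)\<^sup>2 + 2 * f x * S xs + (S xs)\<^sup>2) \<partial>?R) =
      ennreal (measure_pmf.expectation ?R (\<lambda>xs. (f x)\<^sup>2 + 2 * f x * S xs + (S xs)\<^sup>2))"
      by (intro nn_integral_eq_integral) (auto simp: IH E f S0)
    then show "(\<integral>\<^sup>+xs. ennreal ((f x)\<^sup>2 + 2 * f x * S xs + (S xs)\<^sup>2) \<partial>?R) =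
      ennreal ((f x)\<^sup>2 + f x * (2 * (real m * \<mu>)) + ?G)"
      using IH E by (simp add: algebra_simps)
  qed
  also have "\<dots> = ennreal (measure_pmf.expectation p (\<lambda>x. (f x)\<^sup>2 + f x * (2 * (real m * \<mu>)) + ?G))"
    using mu0 f by (intro nn_integral_eq_integral AE_I2 add_nonneg_nonneg[OF add_nonneg_nonneg G0]) auto
  also have "\<dots> = ennreal (real (Suc m) * v + real (Suc m) * (real (Suc m) - 1) * \<mu>\<^sup>2)"
    using f by (simp add: \<mu>_def[symmetric] v_def[symmetric]) (simp add: algebra_simps power2_eq_square)
  finally have 2: "(\<integral>\<^sup>+xs. ennreal ((S xs)\<^sup>2) \<partial>replicate_pmf (Suc m) p) =
    ennreal (real (Suc m) * v + real (Suc m) * (real (Suc m) - 1) * \<mu>\<^sup>2)" .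
  show ?case
    using 2 mu0 v0
    by (subst (asm) nn_integral_eq_integrable) (auto simp: S0)
qed

lemma Chebyshev_replicate_pmf:
  fixes f :: "'a \<Rightarrow> real" and p :: "'a pmf" and m :: nat
  assumes f: "\<And>x. 0 \<le> f x" "integrable p f" "integrable p (\<lambda>x. (f x)\<^sup>2)" and a: "a > 0"
  shows "measure_pmf.prob (replicate_pmf m p)
     {xs. a \<le> \<bar>sum_list (map f xs) - real m * measure_pmf.expectation p f\<bar>}
     \<le> real m * measure_pmf.expectation p (\<lambda>x. (f x)\<^sup>2) / a\<^sup>2"
proof -
  let ?R = "replicate_pmf m p" and ?S = "\<lambda>xs. sum_list (map f xs)"
  note M = second_moment_replicate_pmf[OF f, of m] expectation_sum_list_replicate_pmf[of f p m, OF f(1,2)]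
  have "measure_pmf.prob ?R {xs\<in>space ?R. a \<le> \<bar>?S xs - measure_pmf.expectation ?R ?S\<bar>}
    \<le> measure_pmf.variance ?R ?S / a\<^sup>2"
    using M a by (intro measure_pmf.Chebyshev_inequality) auto
  also have "measure_pmf.variance ?R ?S = real m * measure_pmf.expectation p (\<lambda>x. (f x)\<^sup>2) -
    real m * (measure_pmf.expectation p f)\<^sup>2"
    using M by (subst measure_pmf.variance_eq) (auto simp: algebra_simps power2_eq_square)
  \<comment> \<open>Dropping the squared mean leaves a bound for which only the second moment of
    \<open>f\<close> has to be estimated.\<close>
  also have "\<dots> \<le> real m * measure_pmf.expectation p (\<lambda>x. (f x)\<^sup>2)" by simp
  finally show ?thesis using M a by (simp add: divide_right_mono)
qed

section \<open>Moments of a gap\<close>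

text \<open>Multiplying the generating function of the harmonic numbers by \<open>1 - q\<close>
  takes differences of the coefficients and leaves the logarithm series. With
  \<open>q = 1 - p\<close> and a factor \<open>p\<close> this is the mean \<open>- ln p\<close> of
  \<open>harm\<close> under a geometric law.\<close>

lemma harm_sums:
  fixes q :: real
  assumes q: "0 \<le> q" "q < 1"
  shows "(\<lambda>n. harm n * q ^ n) sums (- ln (1 - q) / (1 - q))"
proof -
  have harm_le: "harm n \<le> real n" for n
  proof (induction n)
    case (Suc n)
    have "inverse (real (Suc n)) \<le> 1" by (simp add: field_simps)
    then show ?case using Suc by (simp add: harm_Suc)
  qed (simp add: harm_def)
  have "summable (\<lambda>n. q ^ n * real n)"
    using geometric_sums_times_n[of q] q by (auto simp: sums_iff)
  then have "summable (\<lambda>n. harm n * q ^ n)"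
    by (rule summable_comparison_test') (use harm_le q in \<open>auto simp: abs_mult mult.commute[of "q ^ _"] intro!: mult_right_mono\<close>)
  then obtain s where s: "(\<lambda>n. harm n * q ^ n) sums s" by (auto simp: summable_def)
  \<comment> \<open>Since \<open>harm 0 = 0\<close>, shifting the index does not change the
    sum.\<close>
  have "(\<lambda>n. harm (Suc n) * q ^ Suc n) sums s"
    using s by (subst sums_Suc_iff) (simp add: harm_def)
  from sums_diff[OF this sums_mult[OF s, of q]]
  have "(\<lambda>n. q ^ Suc n / real (Suc n)) sums (s - q * s)"
    by (simp add: harm_Suc field_simps del: of_nat_Suc)
  moreover have "(\<lambda>n. q ^ Suc n / real (Suc n)) sums (- ln (1 - q))"
    using sums_minus[OF ln_series'[of "- q"]] q by (subst sums_Suc_iff) simp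
  ultimately have "s - q * s = - ln (1 - q)" by (rule sums_unique2)
  then have "s = - ln (1 - q) / (1 - q)" using q by (simp add: field_simps)
  then show ?thesis using s by simp
qed

text \<open>\<open>harm n - ln n\<close> decreases from its value 1 at \<open>n = 1\<close>; the
  shift inside the logarithm covers \<open>n = 0\<close>.\<close>

lemma harm_upper: "harm n \<le> 1 + ln (real n + 1)"
proof (cases n)
  case (Suc m)
  have "harm (Suc m) - ln (real (Suc m)) \<le> harm (Suc 0) - ln (real (Suc 0))"
    using decseqD[OF decseq_harm_diff_ln, of 0 m] by simp
  moreover have "ln (real (Suc m)) \<le> ln (real (Suc m) + 1)" by simp
  moreover have "harm (Suc 0) = (1 :: real)" "ln (real (Suc 0)) = 0" by (simp_all add: harm_def)
  ultimately show ?thesis unfolding Suc by linarith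
qed (simp add: harm_def)

lemma ln_squared_le: "(ln y)\<^sup>2 \<le> y" if "1 \<le> y" for y :: real
proof -
  have half: "ln z \<le> z / 2" if "0 < z" for z :: real
  proof -
    have "ln z = ln (z / 2) + ln 2" using that by (simp add: ln_div)
    also have "\<dots> \<le> (z / 2 - 1) + (2 - 1)"
      using that by (intro add_mono ln_le_minus_one) auto
    finally show ?thesis by simp
  qed
  have "ln y = 2 * ln (sqrt y)" using that by (simp add: ln_sqrt)
  also have "\<dots> \<le> sqrt y" using half[of "sqrt y"] that by simp
  finally have "(ln y)\<^sup>2 \<le> (sqrt y)\<^sup>2" using that by (intro power_mono) auto
  then show ?thesis using that by simp
qed

text \<open>The right-hand side is affine in \<open>n\<close>, so its mean under a gap follows from
  the bound \<open>k\<close> on the mean gap. While \<open>n + 1 \<le> k\<close> the logarithm is at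
  most \<open>ln k\<close>; beyond, the excess \<open>ln ((n + 1) / k)\<close> has a square of at
  most \<open>(n + 1) / k\<close>.\<close>

lemma harm_squared_le:
  assumes k: "k > 0"
  shows "(harm n)\<^sup>2 \<le> 2 * (1 + ln (real k))\<^sup>2 + 2 * (real n + 1) / k"
proof -
  have lnk: "0 \<le> ln (real k)" using k by simp
  have "(harm n)\<^sup>2 \<le> (1 + ln (real n + 1))\<^sup>2"
    by (intro power_mono harm_upper harm_nonneg)
  also have "\<dots> \<le> 2 * (1 + ln (real k))\<^sup>2 + 2 * (real n + 1) / k"
  proof (cases "real n + 1 \<le> k")
    case True
    then have "(1 + ln (real n + 1))\<^sup>2 \<le> (1 + ln (real k))\<^sup>2"
      by (intro power_mono) auto
    moreover have "0 \<le> 2 * (real n + 1) / k" by simp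
    moreover have "0 \<le> (1 + ln (real k))\<^sup>2" by simp
    ultimately show ?thesis by linarith
  next
    case False
    define y where "y = (real n + 1) / k"
    have y: "1 \<le> y" using False k by (simp add: y_def)
    have "ln (real n + 1) = ln (real k) + ln y"
      using k by (simp add: y_def ln_div)
    then have "(1 + ln (real n + 1))\<^sup>2 = ((1 + ln k) + ln y)\<^sup>2" by (simp add: add.assoc)
    also have "\<dots> \<le> 2 * (1 + ln (real k))\<^sup>2 + 2 * (ln y)\<^sup>2"
      using sum_squares_bound[of "1 + ln (real k)" "ln y"] by (simp add: power2_sum)
    also have "\<dots> \<le> 2 * (1 + ln (real k))\<^sup>2 + 2 * y" using ln_squared_le[OF y] by simp
    finally show ?thesis by (simp add: y_def)
  qed
  finally show ?thesis .
qed

lemma expectation_nat_pmf_sums: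
  fixes f :: "nat \<Rightarrow> real"
  assumes f: "\<And>t. 0 \<le> f t" and s: "(\<lambda>t. pmf p t * f t) sums s"
  shows "integrable p f" "measure_pmf.expectation p f = s"
proof -
  have i: "integrable (count_space UNIV) (\<lambda>t. pmf p t * f t)"
    using s f unfolding integrable_count_space_nat_iff by (simp add: sums_iff)
  then show "integrable p f"
    unfolding measure_pmf_eq_density by (subst integrable_density) auto
  have "measure_pmf.expectation p f = (\<integral>t. pmf p t * f t \<partial>count_space UNIV)"
    unfolding measure_pmf_eq_density by (subst integral_density) auto
  also have "\<dots> = s" using i s by (subst integral_count_space_nat) (simp_all add: sums_iff)
  finally show "measure_pmf.expectation p f = s" .
qed

text \<open>Reduces a moment of a gap to one series per element. As \<open>A\<close> is finite, the
  sum over \<open>i\<close> may be exchanged with the series over \<open>t\<close>.\<close>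

lemma expectation_gap_pmf:
  fixes f :: "nat \<Rightarrow> real"
  assumes A: "finite A" "set_pmf D \<subseteq> A" and f: "\<And>t. 0 \<le> f t"
    and s: "\<And>i. i \<in> set_pmf D \<Longrightarrow> (\<lambda>t. (1 - pmf D i) ^ t * pmf D i * f t) sums g i"
  shows "integrable (gap_pmf D) f" "measure_pmf.expectation (gap_pmf D) f = (\<Sum>i\<in>A. pmf D i * g i)"
proof -
  have "pmf (gap_pmf D) t * f t = (\<Sum>i\<in>A. pmf D i * (pmf (geometric_pmf (pmf D i)) t * f t))" for t
    unfolding gap_pmf_def pmf_bind using A
    by (subst integral_measure_pmf_real[of A]) (auto simp: sum_distrib_left mult_ac)
  moreover have "(\<lambda>t. pmf D i * (pmf (geometric_pmf (pmf D i)) t * f t)) sums (pmf D i * g i)" for i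
  proof (cases "i \<in> set_pmf D")
    case True
    then show ?thesis using s[OF True] by (intro sums_mult) (simp add: pmf_positive pmf_le_1)
  next
    case False
    then show ?thesis by (simp add: pmf_eq_0_set_pmf[THEN iffD2])
  qed
  ultimately have "(\<lambda>t. pmf (gap_pmf D) t * f t) sums (\<Sum>i\<in>A. pmf D i * g i)"
    by (simp add: sums_sum)
  from expectation_nat_pmf_sums[OF f this]
  show "integrable (gap_pmf D) f" "measure_pmf.expectation (gap_pmf D) f = (\<Sum>i\<in>A. pmf D i * g i)" .
qed

section \<open>Moments of a gap for a distribution on {1..k}\<close>

context
  fixes D :: "nat pmf" and k :: nat
  assumes D: "set_pmf D \<subseteq> {1..k}"
begin

lemma expectation_harm_gap_pmf:
  shows integrable_harm_gap_pmf: "integrable (gap_pmf D) (harm :: nat \<Rightarrow> real)"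
    and "measure_pmf.expectation (gap_pmf D) harm = ln 2 * shannon_entropy k D"
proof -
  have s: "(\<lambda>t. (1 - pmf D i) ^ t * pmf D i * harm t) sums (- ln (pmf D i))" if "i \<in> set_pmf D" for i
  proof -
    have p: "0 < pmf D i" "pmf D i \<le> 1" using that by (simp_all add: pmf_positive pmf_le_1)
    show ?thesis using sums_mult[OF harm_sums[of "1 - pmf D i"], of "pmf D i"] p
      by (simp add: mult_ac)
  qed
  note E = expectation_gap_pmf[OF finite_atLeastAtMost D harm_nonneg s]
  show "integrable (gap_pmf D) (harm :: nat \<Rightarrow> real)" by (rule E)
  have "measure_pmf.expectation (gap_pmf D) harm = - (\<Sum>i = 1..k. pmf D i * ln (pmf D i))"
    using E(2) by (simp add: sum_negf)
  also have "\<dots> = ln 2 * shannon_entropy k D"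
    unfolding shannon_entropy_def sum_distrib_left sum_negf[symmetric]
    by (intro sum.cong refl) (auto simp: log_def ln_div pmf_nonneg less_le)
  finally show "measure_pmf.expectation (gap_pmf D) harm = ln 2 * shannon_entropy k D" .
qed

lemma expectation_gap_pmf_le:
  shows integrable_gap_pmf: "integrable (gap_pmf D) real"
    and "measure_pmf.expectation (gap_pmf D) real \<le> k"
proof -
  have s: "(\<lambda>t. (1 - pmf D i) ^ t * pmf D i * real t) sums ((1 - pmf D i) / pmf D i)"
    if "i \<in> set_pmf D" for i
  proof -
    have p: "0 < pmf D i" "pmf D i \<le> 1" using that by (simp_all add: pmf_positive pmf_le_1)
    show ?thesis using sums_mult[OF geometric_sums_times_n[of "1 - pmf D i"], of "pmf D i"] p
      by (simp add: mult_ac power2_eq_square)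
  qed
  note E = expectation_gap_pmf[OF finite_atLeastAtMost D of_nat_0_le_iff s]
  show "integrable (gap_pmf D) real" by (rule E)
  have "measure_pmf.expectation (gap_pmf D) real =
      (\<Sum>i = 1..k. pmf D i * ((1 - pmf D i) / pmf D i))"
    by (rule E)
  also have "\<dots> \<le> (\<Sum>i = 1..k. 1)"
    by (intro sum_mono) simp
  finally show "measure_pmf.expectation (gap_pmf D) real \<le> k" by simp
qed

lemma expectation_harm_squared_gap_pmf:
  assumes k: "k \<ge> 2"
  shows "integrable (gap_pmf D) (\<lambda>t. (harm t :: real)\<^sup>2)" (is ?I)
    and "measure_pmf.expectation (gap_pmf D) (\<lambda>t. (harm t)\<^sup>2) \<le> 12 * (log 2 k)\<^sup>2"
proof -
  let ?g = "\<lambda>t. 2 * (1 + ln (real k))\<^sup>2 + 2 * (real t + 1) / k"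
  have g: "integrable (gap_pmf D) ?g" using integrable_gap_pmf by simp
  show I: ?I
    by (rule Bochner_Integration.integrable_bound[OF g])
      (use k in \<open>auto intro!: AE_I2 order_trans[OF harm_squared_le[of k]]\<close>)
  have "measure_pmf.expectation (gap_pmf D) (\<lambda>t. (harm t)\<^sup>2) \<le> measure_pmf.expectation (gap_pmf D) ?g"
    using k by (intro integral_mono I g harm_squared_le) auto
  also have "\<dots> = 2 * (1 + ln (real k))\<^sup>2 + 2 * (measure_pmf.expectation (gap_pmf D) real + 1) / k"
    using integrable_gap_pmf by simp
  also have "\<dots> \<le> 2 * (1 + ln (real k))\<^sup>2 + 2 * (real k + 1) / k"
    using expectation_gap_pmf_le(2) by (intro add_left_mono divide_right_mono) auto
  also have "2 * (real k + 1) / k \<le> 4" using k by (simp add: field_simps)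
  \<comment> \<open>\<open>k \<ge> 2\<close> gives \<open>log 2 k \<ge> 1\<close>, hence
    \<open>1 + ln k \<le> 2 * log 2 k\<close>, and 2 * 4 + 4 = 12.\<close>
  also have "2 * (1 + ln (real k))\<^sup>2 + 4 \<le> 12 * (log 2 k)\<^sup>2"
  proof -
    have l1: "1 \<le> log 2 k" using k by simp
    have "ln (real k) = log 2 k * ln 2" by (simp add: log_def)
    also have "\<dots> \<le> log 2 k * 1" using l1 ln_2_less_1 by (intro mult_left_mono) auto
    finally have "1 + ln (real k) \<le> 2 * log 2 k" using l1 by linarith
    then have "(1 + ln (real k))\<^sup>2 \<le> (2 * log 2 k)\<^sup>2"
      using k by (intro power_mono) auto
    moreover have "1 \<le> (log 2 k)\<^sup>2" using l1 by simp
    ultimately show ?thesis by (simp add: power_mult_distrib)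
  qed
  finally show "measure_pmf.expectation (gap_pmf D) (\<lambda>t. (harm t)\<^sup>2) \<le> 12 * (log 2 k)\<^sup>2" by simp
qed

text \<open>The failure probability 1/3 is split evenly. For accuracy, 72 = 6 * 12 makes Chebyshev's
  bound 1/6. For the stream length, Markov's inequality at 6 times the bound \<open>M * k\<close> on
  the mean gives 1/6; the other \<open>2 * M\<close> samples in \<open>n\<close> are the initial
  draws and the hits.\<close>

lemma prob_gaps:
  assumes k: "k \<ge> 2" and M: "M > 0" and a: "a > 0" "72 * M * (log 2 k)\<^sup>2 \<le> a\<^sup>2" and n: "n = M * (6 * k + 2)"
  shows "measure_pmf.prob (replicate_pmf n D)
    {xs. \<exists>ts. gaps M xs = Some ts \<and> \<bar>sum_list (map harm ts) - M * (ln 2 * shannon_entropy k D)\<bar> \<le> a} \<ge> 2 / 3"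
proof -
  let ?Q = "replicate_pmf M (gap_pmf D)"
  let ?d = "\<lambda>ts. \<bar>sum_list (map harm ts) - M * (ln 2 * shannon_entropy k D)\<bar>"
  let ?A = "{ts. a \<le> ?d ts}"
  let ?B = "{ts. 6 * real M * k \<le> sum_list (map real ts)}"
  let ?G = "{r. \<exists>ts. r = Some ts \<and> ?d ts \<le> a}"
  have "measure_pmf.prob ?Q ?A \<le> M * measure_pmf.expectation (gap_pmf D) (\<lambda>t. (harm t)\<^sup>2) / a\<^sup>2"
    using Chebyshev_replicate_pmf[OF harm_nonneg integrable_harm_gap_pmf
      expectation_harm_squared_gap_pmf(1)[OF k] a(1), of M]
    by (simp add: expectation_harm_gap_pmf)
  also have "\<dots> \<le> M * (12 * (log 2 k)\<^sup>2) / a\<^sup>2"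
    using expectation_harm_squared_gap_pmf(2)[OF k] by (intro divide_right_mono mult_left_mono) auto
  also have "\<dots> \<le> 1 / 6" using a by (simp add: field_simps)
  finally have PA: "measure_pmf.prob ?Q ?A \<le> 1 / 6" .
  have "measure_pmf.prob ?Q {ts \<in> space ?Q. 6 * real M * k \<le> sum_list (map real ts)} \<le>
      measure_pmf.expectation ?Q (\<lambda>ts. sum_list (map real ts)) / (6 * real M * k)"
    using expectation_sum_list_replicate_pmf[of real, OF _ integrable_gap_pmf, of M] M k
    by (intro integral_Markov_inequality_measure[where A = UNIV]) (auto simp: AE_measure_pmf_iff intro!: sum_list_nonneg)
  then have "measure_pmf.prob ?Q ?B \<le> measure_pmf.expectation ?Q (\<lambda>ts. sum_list (map real ts)) / (6 * real M * k)"
    by simp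
  also have "\<dots> = M * measure_pmf.expectation (gap_pmf D) real / (6 * real M * k)"
    using expectation_sum_list_replicate_pmf[of real, OF _ integrable_gap_pmf, of M] by simp
  also have "\<dots> \<le> M * real k / (6 * real M * k)"
    using expectation_gap_pmf_le(2) by (intro divide_right_mono mult_left_mono) auto
  also have "\<dots> = 1 / 6" using M k by simp
  finally have PB: "measure_pmf.prob ?Q ?B \<le> 1 / 6" .
  have in_G: "(if sum_list ts + 2 * M \<le> n then Some ts else None) \<in> ?G" if "ts \<notin> ?A \<union> ?B" for ts
  proof -
    have "real (sum_list ts) = sum_list (map real ts)" by (induction ts) auto
    then have "real (sum_list ts) < real (6 * M * k)" using that by simp
    then have le: "sum_list ts + 2 * M \<le> n" unfolding n of_nat_less_iff by (simp add: algebra_simps)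
    have "?d ts \<le> a" using that by (simp only: Un_iff mem_Collect_eq de_Morgan_disj not_le) linarith
    then show ?thesis unfolding if_P[OF le] by blast
  qed
  have "2 / 3 \<le> 1 - (measure_pmf.prob ?Q ?A + measure_pmf.prob ?Q ?B)" using PA PB by linarith
  also have "\<dots> \<le> 1 - measure_pmf.prob ?Q (?A \<union> ?B)"
    using measure_Un_le[of ?A ?Q ?B] by simp
  also have "\<dots> = measure_pmf.prob ?Q (- (?A \<union> ?B))"
    using measure_pmf.prob_compl[of "?A \<union> ?B" ?Q] by (simp flip: Compl_eq_Diff_UNIV)
  also have "\<dots> \<le> measure_pmf.prob ?Q ((\<lambda>ts. if sum_list ts + 2 * M \<le> n then Some ts else None) -` ?G)"
    using in_G by (intro measure_pmf.finite_measure_mono subsetI) (simp_all only: vimage_eq Compl_iff sets_measure_pmf UNIV_I)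
  also have "\<dots> = measure_pmf.prob (map_pmf (gaps M) (replicate_pmf n D)) ?G"
    unfolding map_gaps_replicate_pmf by simp
  also have "\<dots> = measure_pmf.prob (replicate_pmf n D) {xs. \<exists>ts. gaps M xs = Some ts \<and> ?d ts \<le> a}"
    by (simp add: vimage_def)
  finally show ?thesis .
qed

end

section \<open>Weakest preconditions\<close>

text \<open>Existential, so it asserts termination as well, just as \<open>returns\<close> demands a
  final configuration.\<close>

definition wp :: "nat \<Rightarrow> nat \<Rightarrow> com \<Rightarrow> (config \<Rightarrow> bool) \<Rightarrow> config \<Rightarrow> bool" where
  "wp q w c Q s \<longleftrightarrow> (\<exists>s'. exec q w c s s' \<and> Q s')"

inductive_simps exec_simps:
  "exec q w Skip s s'"
  "exec q w (Const x v) (R, xs, bs) s'"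
  "exec q w (Op x f y z) (R, xs, bs) s'"
  "exec q w (Read x) (R, a # xs, bs) s'"
  "exec q w (IfLess y z c1 c2) s s'"

lemma exec_Seq:
  "exec q w (Seq c1 c2) s s'' \<longleftrightarrow> (\<exists>s'. exec q w c1 s s' \<and> exec q w c2 s' s'')"
proof
  assume "exec q w (Seq c1 c2) s s''"
  then show "\<exists>s'. exec q w c1 s s' \<and> exec q w c2 s' s''" by cases blast
qed (blast intro: exec.Seq)

lemma exec_While:
  "exec q w (WhileLess y z c) s s'' \<longleftrightarrow>
    (if fst s y < fst s z then \<exists>s'. exec q w c s s' \<and> exec q w (WhileLess y z c) s' s'' else s'' = s)"
proof
  assume "exec q w (WhileLess y z c) s s''"
  then show "if fst s y < fst s z then \<exists>s'. exec q w c s s' \<and> exec q w (WhileLess y z c) s' s''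
    else s'' = s"
    by cases (simp_all only: simp_thms if_True if_False, blast)
qed (metis exec.WhileTrue exec.WhileFalse)

lemma wp_simps [simp]:
  "wp q w Skip Q s \<longleftrightarrow> Q s"
  "wp q w (Const x v) Q (R, xs, bs) \<longleftrightarrow> Q (store q w x v R, xs, bs)"
  "wp q w (Op x f y z) Q (R, xs, bs) \<longleftrightarrow> Q (store q w x (aop_val f (R y) (R z)) R, xs, bs)"
  "wp q w (Read x) Q (R, a # xs, bs) \<longleftrightarrow> Q (store q w x a R, xs, bs)"
  "wp q w (Seq c1 c2) Q = wp q w c1 (wp q w c2 Q)"
  "wp q w (IfLess y z c1 c2) Q s \<longleftrightarrow> (if fst s y < fst s z then wp q w c1 Q s else wp q w c2 Q s)"
proof -
  show "wp q w (Seq c1 c2) Q = wp q w c1 (wp q w c2 Q)"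
    unfolding wp_def exec_Seq by blast
  show "wp q w (IfLess y z c1 c2) Q s \<longleftrightarrow> (if fst s y < fst s z then wp q w c1 Q s else wp q w c2 Q s)"
    unfolding wp_def exec_simps by (cases "fst s y < fst s z") (simp_all only: simp_thms if_True if_False)
qed (simp_all add: wp_def exec_simps)

text \<open>The loop reappears on the right, so this is not a simp rule; each loop proof unfolds it
  once and continues by induction.\<close>

lemma wp_While:
  "wp q w (WhileLess y z c) Q s \<longleftrightarrow>
    (if fst s y < fst s z then wp q w c (wp q w (WhileLess y z c) Q) s else Q s)"
  unfolding wp_def by (subst exec_While, cases "fst s y < fst s z") (simp_all only: simp_thms if_True if_False, blast)

section \<open>The program\<close>

text \<open>
  Register usage: 0 = \<open>k\<close> and 1 = \<open>\<lceil>1 / \<epsilon>\<rceil>\<close>, both overwritten by the result; 2 = \<open>N\<close>;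
  3 = the fixed-point unit \<open>S\<close>; 4 = \<open>\<lfloor>log 2 k\<rfloor> + 1\<close>; 5 = the number \<open>M\<close> of repetitions;
  6 = accumulated harmonic numbers times \<open>S\<close>; 7 = \<open>ln 2\<close> times \<open>S\<close>; 8 = loop counter;
  9 = awaited sample; 10 = number of misses; 11 = current sample; 12, 13 = scratch;
  14 and 15 hold the constants 1 and 0.
  The factor \<open>4608 = 12 * 6 * 8\<^sup>2\<close> in \<open>M\<close> makes the failure probability in Chebyshev's inequality,
  for variance \<open>12 (log 2 k)\<^sup>2\<close> and deviation \<open>\<epsilon> / 8\<close>, at most \<open>1 / 6\<close>.
  The first round of \<open>wait_loop\<close> divides by 0, which conveniently contributes 0.
\<close>

definition log_loop :: com where
  "log_loop = WhileLess 15 13 (Seq (Op 13 Quot 13 12) (Op 4 Add 4 14))"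

definition ln2_loop :: com where
  "ln2_loop = WhileLess 8 13 (Seq (Op 8 Add 8 14) (Seq (Op 12 Quot 3 8) (Op 7 Add 7 12)))"

definition wait_loop :: com where
  "wait_loop = WhileLess 15 12
    (Seq (Op 13 Quot 3 10) (Seq (Op 6 Add 6 13) (Seq (Op 10 Add 10 14) (Seq (Read 11)
    (Seq (Op 12 Sub 11 9) (Seq (Op 13 Sub 9 11) (Op 12 Add 12 13)))))))"

definition gaps_loop :: com where
  "gaps_loop = WhileLess 8 5
    (Seq (Read 9) (Seq (Const 10 0) (Seq (Const 12 1) (Seq wait_loop (Op 8 Add 8 14)))))"

fun seqs :: "com list \<Rightarrow> com" where
  "seqs [] = Skip"
| "seqs (c # cs) = Seq c (seqs cs)"

definition entropy_prog :: com where
  "entropy_prog = Seq (Const 14 1) (IfLess 14 0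
    (seqs [Const 12 2, Op 13 Add 0 15, log_loop,
      Const 13 100, Op 2 Mul 0 1, Op 2 Mul 2 13,
      Op 3 Mul 2 2,
      Op 5 Mul 4 1, Op 5 Mul 5 5, Const 13 4608, Op 5 Mul 5 13,
      Op 8 Add 2 15, Op 13 Add 2 2, ln2_loop,
      Const 8 0, gaps_loop,
      Op 1 Mul 5 7, Op 0 Add 6 15])
    (Const 0 0))"

section \<open>Total correctness of the loops, with overflow bounds\<close>

text \<open>The bound on \<open>R 4 + R 13\<close> is inductive: a round raises the count by 1,
  while halving lowers a positive \<open>R 13\<close> by at least 1.\<close>

lemma wp_log_loop:
  assumes "R 15 = 0" "R 14 = 1" "R 12 = 2" "R 4 + R 13 < 2 ^ w"
    and "\<And>R'. \<lbrakk>R' 4 = R 4 + floorlog 2 (R 13); \<And>r. r \<notin> {4, 13} \<Longrightarrow> R' r = R r\<rbrakk> \<Longrightarrow> Q (R', xs, bs)"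
  shows "wp 16 w log_loop Q (R, xs, bs)"
  using assms
proof (induction "R 13" arbitrary: R rule: less_induct)
  case less
  show ?case
  proof (cases "R 13 = 0")
    case True
    then show ?thesis using less.prems
      unfolding log_loop_def by (subst wp_While) (simp add: floorlog_def)
  next
    case False
    let ?R = "R(13 := R 13 div 2, 4 := R 4 + 1)"
    have small: "R 13 div 2 < 2 ^ w" "R 4 + 1 < 2 ^ w" using less.prems(4) False by auto
    have "wp 16 w log_loop Q (?R, xs, bs)"
    proof (rule less.hyps)
      show "?R 4 + ?R 13 < 2 ^ w" using less.prems(4) False by simp
      fix R' assume R': "R' 4 = ?R 4 + floorlog 2 (?R 13)" "\<And>r. r \<notin> {4, 13} \<Longrightarrow> R' r = ?R r"
      show "Q (R', xs, bs)"
        using R' False by (intro less.prems(5)) (auto simp: compute_floorlog[of 2 "R 13"])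
    qed (use less.prems False in auto)
    then show ?thesis using less.prems(1-3) False small
      unfolding log_loop_def by (subst wp_While) (simp add: store_def)
  qed
qed

text \<open>\<open>(R 13 - R 8) * R 3\<close> is the overflow budget: each remaining round adds a
  quotient of at most \<open>R 3\<close>.\<close>

lemma wp_ln2_loop:
  assumes "R 14 = 1" "R 8 \<le> R 13" "R 13 < 2 ^ w" "R 3 < 2 ^ w"
    "R 7 + (R 13 - R 8) * R 3 < 2 ^ w"
    and "\<And>R'. \<lbrakk>R' 7 = R 7 + (\<Sum>j\<in>{R 8<..R 13}. R 3 div j);
      \<And>r. r \<notin> {7, 8, 12} \<Longrightarrow> R' r = R r\<rbrakk> \<Longrightarrow> Q (R', xs, bs)"
  shows "wp 16 w ln2_loop Q (R, xs, bs)"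
  using assms
proof (induction "R 13 - R 8" arbitrary: R)
  case 0
  then show ?case unfolding ln2_loop_def by (subst wp_While) simp
next
  case (Suc d)
  define y where "y = R 3 div (R 8 + 1)"
  let ?R = "R(8 := R 8 + 1, 12 := y, 7 := R 7 + y)"
  have lt: "R 8 < R 13" using Suc.hyps(2) by simp
  have y: "y \<le> R 3" by (simp add: y_def)
  obtain e where "R 13 = Suc (R 8 + e)" using lt less_iff_Suc_add by blast
  then have step: "(R 13 - R 8) * R 3 = R 3 + (R 13 - (R 8 + 1)) * R 3"
    by simp
  have small: "R 8 + 1 < 2 ^ w" "y < 2 ^ w" "R 7 + y < 2 ^ w"
    using Suc.prems lt y step by linarith+
  have "wp 16 w ln2_loop Q (?R, xs, bs)"
  proof (rule Suc.hyps)
    show "?R 7 + (?R 13 - ?R 8) * ?R 3 < 2 ^ w" using Suc.prems(5) step y by simp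
    fix R' assume R': "R' 7 = ?R 7 + (\<Sum>j\<in>{?R 8<..?R 13}. ?R 3 div j)"
      "\<And>r. r \<notin> {7, 8, 12} \<Longrightarrow> R' r = ?R r"
    have "{R 8<..R 13} = insert (R 8 + 1) {R 8 + 1<..R 13}" using lt by auto
    then show "Q (R', xs, bs)"
      using R' by (intro Suc.prems(6)) (auto simp: y_def)
  qed (use Suc lt in auto)
  then show ?case using Suc.prems(1) lt small
    unfolding ln2_loop_def by (subst wp_While) (simp add: store_def y_def)
qed

text \<open>Each sample read adds at most \<open>R 3\<close> to the accumulator, so
  \<open>R 6 + R 3 * length xs\<close> does not grow. Success of \<open>wait\<close> ensures that
  every \<open>Read\<close> finds a sample. With \<open>t\<close> misses there are
  \<open>t + 1\<close> rounds, hence the closed interval of summation.\<close>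

lemma wp_wait_loop:
  assumes "R 15 = 0" "R 14 = 1" "R 12 > 0" "R 9 < 2 ^ w" "set xs \<subseteq> {..<2 ^ w}"
    "R 10 + length xs < 2 ^ w" "R 3 < 2 ^ w" "R 6 + R 3 * length xs < 2 ^ w"
    and "wait (R 9) xs = Some (t, ys)"
    and "\<And>R'. \<lbrakk>R' 6 = R 6 + (\<Sum>j\<in>{R 10..R 10 + t}. R 3 div j);
      \<And>r. r \<notin> {6, 10, 11, 12, 13} \<Longrightarrow> R' r = R r\<rbrakk> \<Longrightarrow> Q (R', ys, bs)"
  shows "wp 16 w wait_loop Q (R, xs, bs)"
  using assms
proof (induction xs arbitrary: R t)
  case Nil
  then show ?case by simp
next
  case (Cons x xs)
  define y where "y = R 3 div R 10"
  \<comment> \<open>The distance of \<open>x\<close> and \<open>R 9\<close>, as a sum of two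
    truncated subtractions of which at least one is 0. It vanishes exactly on a hit, which gives an
    equality test to a loop that can only compare by \<open><\<close>.\<close>
  define d where "d = (x - R 9) + (R 9 - x)"
  let ?R = "R(6 := R 6 + y, 10 := R 10 + 1, 11 := x, 13 := R 9 - x, 12 := d)"
  have y: "y \<le> R 3" by (simp add: y_def)
  have small: "y < 2 ^ w" "R 6 + y < 2 ^ w" "R 10 + 1 < 2 ^ w" "x < 2 ^ w" "R 9 - x < 2 ^ w"
      "x - R 9 < 2 ^ w" "d < 2 ^ w"
    using Cons.prems y by (auto simp: d_def)
  have "wp 16 w wait_loop Q (?R, xs, bs)"
  proof (cases "x = R 9")
    case True
    then have "t = 0" "ys = xs" using Cons.prems(9) by auto
    have "Q (?R, ys, bs)" using \<open>t = 0\<close> by (intro Cons.prems(10)) (auto simp: y_def)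
    then show ?thesis using Cons.prems(1) True \<open>ys = xs\<close>
      unfolding wait_loop_def by (subst wp_While) (simp add: d_def)
  next
    case False
    then obtain t' where t': "t = Suc t'" "wait (R 9) xs = Some (t', ys)"
      using Cons.prems(9) by (cases "wait (R 9) xs") auto
    show ?thesis
    proof (rule Cons.IH)
      show "?R 12 > 0" using False by (auto simp: d_def)
      show "?R 6 + ?R 3 * length xs < 2 ^ w" using Cons.prems(8) y by simp
      show "wait (?R 9) xs = Some (t', ys)" using t' by simp
      fix R' assume R': "R' 6 = ?R 6 + (\<Sum>j\<in>{?R 10..?R 10 + t'}. ?R 3 div j)"
        "\<And>r. r \<notin> {6, 10, 11, 12, 13} \<Longrightarrow> R' r = ?R r"
      have "{R 10..R 10 + t} = insert (R 10) {R 10 + 1..R 10 + 1 + t'}" using t' by auto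
      then show "Q (R', ys, bs)"
        using R' by (intro Cons.prems(10)) (auto simp: y_def)
    qed (use Cons.prems in auto)
  qed
  \<comment> \<open>Registers 12 and 13 are written twice in a round; only the last values
    survive.\<close>
  moreover have "R(13 := y, 6 := R 6 + y, 10 := R 10 + 1, 11 := x, 12 := x - R 9, 13 := R 9 - x, 12 := d) = ?R"
    by (auto simp: fun_eq_iff)
  ultimately show ?case using Cons.prems(1-3) small
    unfolding wait_loop_def
    by (subst wp_While) (simp add: store_def flip: y_def, simp add: d_def)
qed

lemma wait_SomeD:
  assumes "wait i xs = Some (t, ys)"
  shows "set ys \<subseteq> set xs" "length xs = length ys + t + 1"
  using assms by (induction xs arbitrary: t) (fastforce split: if_splits)+

text \<open>The fixed-point version of \<open>S * harm t\<close>. Index 0 is included to match the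
  loop, whose miss counter starts at 0; its quotient is 0.\<close>

definition scaled_harm :: "nat \<Rightarrow> nat \<Rightarrow> nat" where
  "scaled_harm S t = (\<Sum>j\<le>t. S div j)"

lemma scaled_harm_le: "scaled_harm S t \<le> S * t"
proof -
  have "scaled_harm S t = (\<Sum>j\<in>{1..t}. S div j)"
    unfolding scaled_harm_def by (rule sum.mono_neutral_right) (auto simp: Suc_le_eq)
  also have "\<dots> \<le> (\<Sum>j\<in>{1..t}. S)" by (intro sum_mono) simp
  finally show ?thesis by (simp add: mult.commute)
qed

text \<open>A gap \<open>t\<close> consumes \<open>t + 2\<close> samples and adds at most
  \<open>R 3 * t\<close>, so the budget of \<open>R 3\<close> per unread sample carries over to the
  next repetition.\<close>

lemma wp_gaps_loop:
  assumes "R 15 = 0" "R 14 = 1" "set xs \<subseteq> {..<2 ^ w}"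
    "length xs < 2 ^ w" "R 3 < 2 ^ w" "R 6 + R 3 * length xs < 2 ^ w" "R 5 < 2 ^ w"
    "R 8 + m = R 5" "w > 0"
    and "gaps m xs = Some ts"
    and "\<And>R' ys. \<lbrakk>R' 6 = R 6 + sum_list (map (scaled_harm (R 3)) ts);
      \<And>r. r \<notin> {6, 8, 9, 10, 11, 12, 13} \<Longrightarrow> R' r = R r\<rbrakk> \<Longrightarrow> Q (R', ys, bs)"
  shows "wp 16 w gaps_loop Q (R, xs, bs)"
  using assms
proof (induction m arbitrary: R xs ts)
  case 0
  then show ?case unfolding gaps_loop_def by (subst wp_While) simp
next
  case (Suc m)
  from Suc.prems(10) obtain x us t ys ts' where
    xs: "xs = x # us" and t: "wait x us = Some (t, ys)" and ts: "gaps m ys = Some ts'" "ts = t # ts'"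
    by (auto split: list.splits option.splits)
  note D = wait_SomeD[OF t]
  let ?R = "R(9 := x, 10 := 0, 12 := 1)"
  have "wp 16 w wait_loop (wp 16 w (Seq (Op 8 Add 8 14) gaps_loop) Q) (?R, us, bs)"
  proof (rule wp_wait_loop)
    fix R' assume R': "R' 6 = ?R 6 + (\<Sum>j\<in>{?R 10..?R 10 + t}. ?R 3 div j)"
      "\<And>r. r \<notin> {6, 10, 11, 12, 13} \<Longrightarrow> R' r = ?R r"
    have R'6: "R' 6 = R 6 + scaled_harm (R 3) t"
      using R'(1) by (simp add: scaled_harm_def atLeast0AtMost)
    have R'r: "r \<notin> {6, 9, 10, 11, 12, 13} \<Longrightarrow> R' r = R r" for r using R'(2)[of r] by simp
    have "wp 16 w gaps_loop Q (R'(8 := R 8 + 1), ys, bs)"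
    proof (rule Suc.IH)
      have "R 3 * t + R 3 * length ys \<le> R 3 * length xs"
        unfolding xs distrib_left[symmetric] using D by (intro mult_le_mono2) simp
      then show "(R'(8 := R 8 + 1)) 6 + (R'(8 := R 8 + 1)) 3 * length ys < 2 ^ w"
        using Suc.prems(6) scaled_harm_le[of "R 3" t] by (simp add: R'6 R'r)
      fix R'' zs assume "R'' 6 = (R'(8 := R 8 + 1)) 6 + sum_list (map (scaled_harm ((R'(8 := R 8 + 1)) 3)) ts')"
        "\<And>r. r \<notin> {6, 8, 9, 10, 11, 12, 13} \<Longrightarrow> R'' r = (R'(8 := R 8 + 1)) r"
      then show "Q (R'', zs, bs)"
        by (intro Suc.prems(11)) (simp_all add: R'6 R'r ts)
    qed (use Suc.prems D xs ts in \<open>auto simp: R'r\<close>)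
    then show "wp 16 w (Seq (Op 8 Add 8 14) gaps_loop) Q (R', ys, bs)"
      using Suc.prems by (simp add: store_def R'r)
  qed (use Suc.prems xs t in auto)
  then show ?case
    using Suc.prems xs unfolding gaps_loop_def
    by (subst wp_While) (simp add: store_def)
qed

definition ln2_sum :: "nat \<Rightarrow> nat \<Rightarrow> nat" where
  "ln2_sum S N = (\<Sum>j\<in>{N<..2 * N}. S div j)"

lemma ln2_sum_le: "ln2_sum S N \<le> N * S"
proof -
  have "ln2_sum S N \<le> (\<Sum>j\<in>{N<..2 * N}. S)" unfolding ln2_sum_def by (intro sum_mono) simp
  then show ?thesis by simp
qed

lemma gaps_SomeD:
  assumes "gaps m xs = Some ts"
  shows "sum_list ts + 2 * m \<le> length xs"
  using assms
  by (induction m arbitrary: xs ts) (fastforce split: list.splits option.splits dest: wait_SomeD)+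

text \<open>One inequality on \<open>w\<close> rules out every overflow: its left side bounds all
  values written, in particular the numerator, at most \<open>n * S\<close>, and the denominator, at
  most \<open>M * N * S\<close>.\<close>

lemma wp_entropy_prog:
  assumes k: "k \<ge> 2" and E: "E \<ge> 1" and L: "L = floorlog 2 k" and N: "N = k * E * 100" and S: "S = N * N"
    and M: "M = L * E * (L * E) * 4608" and n: "n = M * (6 * k + 2)"
    and w: "w > 0" "M * N * S * (6 * k + 2) < 2 ^ w"
    and xs: "length xs = n" "set xs \<subseteq> {1..k}" and ts: "gaps M xs = Some ts"
    and R: "R 0 = k" "R 1 = E" "\<And>r. r \<ge> 2 \<Longrightarrow> R r = 0"
    and Q: "\<And>R' ys. \<lbrakk>R' 0 = sum_list (map (scaled_harm S) ts); R' 1 = M * ln2_sum S N\<rbrakk> \<Longrightarrow> Q (R', ys, bs)"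
  shows "wp 16 w entropy_prog Q (R, xs, bs)"
proof -
  have L1: "1 \<le> L" unfolding L using k by (simp add: floorlog_def)
  have Lk: "L \<le> k" unfolding L by (intro floorlog_leI) simp_all
  have M1: "4608 \<le> M" unfolding M using L1 E by simp
  have "2 \<le> k * E" using mult_le_mono[OF k E] by simp
  then have N1: "k * E \<le> N" "200 \<le> N" unfolding N by linarith+
  have S1: "N \<le> S" unfolding S using N1 by (cases N) auto
  have prod_le: "a \<le> a * b" if "1 \<le> b" for a b :: nat using that by (cases b) auto
  have V: "M * S * N * 2 \<le> M * N * S * (6 * k + 2)" "M * (6 * k + 2) * S \<le> M * N * S * (6 * k + 2)"
  proof -
    have "M * S * N * 2 \<le> M * S * N * (6 * k + 2)" by (intro mult_le_mono2) simp
    then show "M * S * N * 2 \<le> M * N * S * (6 * k + 2)" by (simp only: mult_ac)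
    have "M * (6 * k + 2) * S * 1 \<le> M * (6 * k + 2) * S * N" using N1 by (intro mult_le_mono2) simp
    then show "M * (6 * k + 2) * S \<le> M * N * S * (6 * k + 2)" by (simp only: mult_ac mult_1_right)
  qed
  have small: "M * S * N * 2 < 2 ^ w" "n * S < 2 ^ w"
    using le_less_trans[OF V(1) w(2)] le_less_trans[OF V(2) w(2)] unfolding n by simp_all
  have eqs: "M * (S * N * 2) = M * S * N * 2" "S * (M * N * 2) = M * S * N * 2"
      "2 * N * (M * S) = M * S * N * 2" "N * S * (M * 2) = M * S * N * 2"
      "M * (N * S) * 2 = M * S * N * 2"
    by simp_all
  have "M \<le> M * (S * N * 2)" "S \<le> S * (M * N * 2)" "2 * N \<le> 2 * N * (M * S)"
      "N * S \<le> N * S * (M * 2)" "M * (N * S) \<le> M * (N * S) * 2" and nS: "n \<le> n * S"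
    using M1 S1 N1 by (intro prod_le; simp add: Suc_le_eq)+
  then have small': "M < 2 ^ w" "S < 2 ^ w" "2 * N < 2 ^ w" "N * S < 2 ^ w" "M * (N * S) < 2 ^ w"
    unfolding eqs using small(1) by (meson le_less_trans)+
  have small_n: "n < 2 ^ w" using nS small(2) by (rule le_less_trans)
  have le: "L * E \<le> N" using Lk N1 by (meson le_trans mult_le_mono1)
  have kE: "k \<le> k * E" "E \<le> k * E" using k E by simp_all
  have "L * E * (L * E) \<le> M" unfolding M by simp
  then have small2: "L * E * (L * E) < 2 ^ w" "L * E < 2 ^ w" "k * E < 2 ^ w" "k < 2 ^ w" "E < 2 ^ w"
      "4608 < (2::nat) ^ w" "100 < (2::nat) ^ w" "2 < (2::nat) ^ w" "1 < (2::nat) ^ w" "N < 2 ^ w" "L + k < 2 ^ w"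
    using small' le N1 M1 Lk k kE by linarith+
  have L_def: "floorlog 2 k = L" by (simp add: L)
  \<comment> \<open>Suffixes of the program are treated from the end backwards, each under
    assumptions on the registers it depends on.\<close>
  have final: "wp 16 w (seqs [Op 1 Mul 5 7, Op 0 Add 6 15]) Q (R', ys, bs)"
    if "R' 5 = M" "R' 7 = ln2_sum S N" "R' 6 = sum_list (map (scaled_harm S) ts)" "R' 15 = 0" for R' ys
  proof -
    have "sum_list (map (scaled_harm S) ts) \<le> S * sum_list ts"
      using sum_list_mono[of ts "scaled_harm S" "(*) S"] scaled_harm_le by (simp add: sum_list_const_mult)
    also have "\<dots> \<le> S * n" using gaps_SomeD[OF ts] xs by (intro mult_le_mono2) simp
    finally have "sum_list (map (scaled_harm S) ts) < 2 ^ w" using small by (simp add: mult.commute)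
    moreover have "M * ln2_sum S N < 2 ^ w"
      using small'(5) ln2_sum_le[of S N] by (meson le_less_trans mult_le_mono2)
    ultimately show ?thesis using that by (simp add: store_def Q)
  qed
  have gaps: "wp 16 w (seqs [Const 8 0, gaps_loop, Op 1 Mul 5 7, Op 0 Add 6 15]) Q (R', xs, bs)"
    if "R' 3 = S" "R' 5 = M" "R' 7 = ln2_sum S N" "R' 6 = 0" "R' 14 = 1" "R' 15 = 0" for R'
  proof -
    have "wp 16 w gaps_loop (wp 16 w (seqs [Op 1 Mul 5 7, Op 0 Add 6 15]) Q) (R'(8 := 0), xs, bs)"
    proof (rule wp_gaps_loop[OF _ _ _ _ _ _ _ _ _ ts])
      show "set xs \<subseteq> {..<2 ^ w}" using xs small2 by auto
      fix R'' ys assume "R'' 6 = (R'(8 := 0)) 6 + sum_list (map (scaled_harm ((R'(8 := 0)) 3)) ts)"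
        "\<And>r. r \<notin> {6, 8, 9, 10, 11, 12, 13} \<Longrightarrow> R'' r = (R'(8 := 0)) r"
      then show "wp 16 w (seqs [Op 1 Mul 5 7, Op 0 Add 6 15]) Q (R'', ys, bs)"
        by (intro final) (simp_all add: that)
    qed (use small small' small_n xs w in \<open>simp_all add: that mult.commute\<close>)
    then show ?thesis by (simp add: store_def)
  qed
  have ln2: "wp 16 w (seqs [Op 8 Add 2 15, Op 13 Add 2 2, ln2_loop,
      Const 8 0, gaps_loop, Op 1 Mul 5 7, Op 0 Add 6 15]) Q (R', xs, bs)"
    if "R' 2 = N" "R' 3 = S" "R' 5 = M" "R' 6 = 0" "R' 7 = 0" "R' 14 = 1" "R' 15 = 0" for R'
  proof -
    have "wp 16 w ln2_loop (wp 16 w (seqs [Const 8 0, gaps_loop, Op 1 Mul 5 7, Op 0 Add 6 15]) Q)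
        (R'(8 := N, 13 := 2 * N), xs, bs)"
    proof (rule wp_ln2_loop)
      fix R'' assume "R'' 7 = (R'(8 := N, 13 := 2 * N)) 7 +
          (\<Sum>j\<in>{(R'(8 := N, 13 := 2 * N)) 8<..(R'(8 := N, 13 := 2 * N)) 13}. (R'(8 := N, 13 := 2 * N)) 3 div j)"
        "\<And>r. r \<notin> {7, 8, 12} \<Longrightarrow> R'' r = (R'(8 := N, 13 := 2 * N)) r"
      then show "wp 16 w (seqs [Const 8 0, gaps_loop, Op 1 Mul 5 7, Op 0 Add 6 15]) Q (R'', xs, bs)"
        by (intro gaps) (simp_all add: that ln2_sum_def)
    qed (use small' in \<open>simp_all add: that\<close>)
    then show ?thesis using that small2 small' by (simp add: store_def mult_2)
  qed
  have params: "wp 16 w (seqs [Const 13 100, Op 2 Mul 0 1, Op 2 Mul 2 13,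
      Op 3 Mul 2 2, Op 5 Mul 4 1, Op 5 Mul 5 5, Const 13 4608, Op 5 Mul 5 13,
      Op 8 Add 2 15, Op 13 Add 2 2, ln2_loop,
      Const 8 0, gaps_loop, Op 1 Mul 5 7, Op 0 Add 6 15]) Q (R', xs, bs)"
    if "R' 0 = k" "R' 1 = E" "R' 4 = L" "R' 6 = 0" "R' 7 = 0" "R' 14 = 1" "R' 15 = 0" for R'
  proof -
    have "wp 16 w (seqs [Op 8 Add 2 15, Op 13 Add 2 2, ln2_loop,
      Const 8 0, gaps_loop, Op 1 Mul 5 7, Op 0 Add 6 15]) Q
      (R'(13 := 100, 2 := k * E, 2 := N, 3 := S, 5 := L * E, 5 := L * E * (L * E), 13 := 4608, 5 := M), xs, bs)"
      by (rule ln2) (use that in simp_all)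
    then show ?thesis using that small2 small'
      by (simp add: store_def flip: N S M)
  qed
  have "wp 16 w log_loop (wp 16 w (seqs [Const 13 100, Op 2 Mul 0 1, Op 2 Mul 2 13,
      Op 3 Mul 2 2, Op 5 Mul 4 1, Op 5 Mul 5 5, Const 13 4608, Op 5 Mul 5 13,
      Op 8 Add 2 15, Op 13 Add 2 2, ln2_loop,
      Const 8 0, gaps_loop, Op 1 Mul 5 7, Op 0 Add 6 15]) Q)
      (R(14 := 1, 12 := 2, 13 := k), xs, bs)"
  proof (rule wp_log_loop)
    fix R' assume "R' 4 = (R(14 := 1, 12 := 2, 13 := k)) 4 + floorlog 2 ((R(14 := 1, 12 := 2, 13 := k)) 13)"
      "\<And>r. r \<notin> {4, 13} \<Longrightarrow> R' r = (R(14 := 1, 12 := 2, 13 := k)) r"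
    then show "wp 16 w (seqs [Const 13 100, Op 2 Mul 0 1, Op 2 Mul 2 13,
      Op 3 Mul 2 2, Op 5 Mul 4 1, Op 5 Mul 5 5, Const 13 4608, Op 5 Mul 5 13,
      Op 8 Add 2 15, Op 13 Add 2 2, ln2_loop,
      Const 8 0, gaps_loop, Op 1 Mul 5 7, Op 0 Add 6 15]) Q (R', xs, bs)"
      by (intro params) (simp_all add: R L_def del: One_nat_def)
  qed (use small2 in \<open>simp_all add: R del: One_nat_def\<close>)
  then show ?thesis using R k small2 w(1) unfolding entropy_prog_def
    by (simp add: store_def)
qed

section \<open>Accuracy of the fixed-point estimate\<close>

text \<open>Compares \<open>1 / j\<close> with the increments \<open>ln (j + 1) - ln j\<close> from
  below and \<open>ln j - ln (j - 1)\<close> from above.\<close>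

lemma sum_inverse_bounds:
  assumes "N > 0"
  shows "ln (real (N + d + 1)) - ln (real (N + 1)) \<le> (\<Sum>j\<in>{N<..N + d}. 1 / real j)"
    and "(\<Sum>j\<in>{N<..N + d}. 1 / real j) \<le> ln (real (N + d)) - ln (real N)"
proof (induction d)
  case 0
  {
    case 1
    show ?case by simp
  next
    case 2
    show ?case by simp
  }
next
  case (Suc d)
  have ins: "{N<..N + Suc d} = insert (N + d + 1) {N<..N + d}" by auto
  have up: "ln (x + 1) - ln x \<le> 1 / x" if "x > 0" for x :: real
    using ln_add_one_self_le_self[of "1 / x"] that by (simp add: field_simps ln_div)
  have lo: "1 / (x + 1) \<le> ln (x + 1) - ln x" if "x > 0" for x :: real
    using ln_le_minus_one[of "x / (x + 1)"] that by (simp add: ln_div field_simps)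
  {
    case 1
    show ?case using Suc(1) up[of "real (N + d + 1)"] unfolding ins by (simp add: add_ac)
  next
    case 2
    show ?case using Suc(2) lo[of "real (N + d)"] assms unfolding ins by (simp add: add_ac)
  }
qed

lemma div_bounds: "real S / real j - 1 \<le> real (S div j)" "real (S div j) \<le> real S / real j"
proof -
  show "real (S div j) \<le> real S / real j" by (rule of_nat_div_le_of_nat)
  have "real S / real j < real (S div j) + 1"
    using floor_divide_of_nat_eq[of S j, where ?'a = real] by linarith
  then show "real S / real j - 1 \<le> real (S div j)" by simp
qed

text \<open>Two errors of at most \<open>N\<close> each: the sum of \<open>1 / j\<close> falls short
  of \<open>ln 2\<close> by at most \<open>1 / N\<close>, which the factor \<open>S = N * N\<close>
  turns into \<open>N\<close>, and each of the \<open>N\<close> quotients is rounded down by at most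
  1.\<close>

lemma ln2_sum_bounds:
  assumes N: "N > 0" and S: "S = N * N"
  shows "\<bar>real (ln2_sum S N) - real S * ln 2\<bar> \<le> 2 * real N"
proof -
  let ?h = "\<Sum>j\<in>{N<..N + N}. 1 / real j"
  have "?h \<le> ln (real (N + N)) - ln (real N)" by (rule sum_inverse_bounds(2)[OF N])
  also have "\<dots> = ln 2" using N ln_mult[of 2 "real N"] by simp
  finally have up: "?h \<le> ln 2" .
  have "ln (real (2 * N + 2)) - ln (real (2 * N + 1)) \<le> 1 / real N"
  proof -
    have "ln (real (2 * N + 2)) - ln (real (2 * N + 1)) = ln (real (2 * N + 2) / real (2 * N + 1))"
      by (subst ln_div) auto
    also have "real (2 * N + 2) / real (2 * N + 1) = 1 + 1 / real (2 * N + 1)"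
      by (simp add: field_simps)
    also have "ln (1 + 1 / real (2 * N + 1)) \<le> 1 / real (2 * N + 1)" by (intro ln_add_one_self_le_self) simp
    also have "\<dots> \<le> 1 / real N" using N by (simp add: field_simps)
    finally show ?thesis .
  qed
  moreover have "ln (real (2 * N + 2)) = ln 2 + ln (real (N + 1))"
    using ln_mult[of 2 "real (N + 1)"] by (simp add: algebra_simps)
  moreover have "N + N + 1 = 2 * N + 1" by simp
  ultimately have lo: "ln 2 - 1 / real N \<le> ?h"
    using sum_inverse_bounds(1)[OF N, of N] by (simp only:)
  have "real (ln2_sum S N) \<le> (\<Sum>j\<in>{N<..N + N}. real S / real j)"
    unfolding ln2_sum_def of_nat_sum mult_2 by (intro sum_mono div_bounds)
  also have "\<dots> = real S * ?h" by (simp add: sum_distrib_left)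
  also have "\<dots> \<le> real S * ln 2" using up by (intro mult_left_mono) auto
  finally have 1: "real (ln2_sum S N) \<le> real S * ln 2" .
  have "real S * ln 2 - real N = real S * (ln 2 - 1 / real N)"
    using N S by (simp add: field_simps)
  also have "\<dots> \<le> real S * ?h" using lo by (intro mult_left_mono) auto
  also have "\<dots> = (\<Sum>j\<in>{N<..N + N}. real S / real j - 1) + real N"
    by (simp add: sum_distrib_left sum_subtractf)
  also have "\<dots> \<le> real (ln2_sum S N) + real N"
    unfolding ln2_sum_def of_nat_sum mult_2 by (intro add_right_mono sum_mono div_bounds)
  finally show ?thesis using 1 by linarith
qed

lemma scaled_harm_bounds:
  "real S * harm t - real t \<le> real (scaled_harm S t)" "real (scaled_harm S t) \<le> real S * harm t"
proof (induction t)
  case 0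
  {
    case 1
    show ?case by (simp add: scaled_harm_def harm_def)
  next
    case 2
    show ?case by (simp add: scaled_harm_def harm_def)
  }
next
  case (Suc t)
  have eq: "scaled_harm S (Suc t) = scaled_harm S t + S div Suc t" by (simp add: scaled_harm_def)
  {
    case 1
    show ?case using Suc(1) div_bounds(1)[of S "Suc t"] unfolding eq harm_Suc of_nat_add
      by (simp add: distrib_left divide_inverse)
  next
    case 2
    show ?case using Suc(2) div_bounds(2)[of S "Suc t"] unfolding eq harm_Suc of_nat_add
      by (simp add: distrib_left divide_inverse)
  }
qed

lemma sum_list_scaled_harm_bounds:
  "real S * sum_list (map harm ts) - real (sum_list ts) \<le> real (sum_list (map (scaled_harm S) ts))"
  "real (sum_list (map (scaled_harm S) ts)) \<le> real S * sum_list (map harm ts)"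
proof (induction ts)
  case (Cons t ts)
  {
    case 1
    show ?case using Cons(1) scaled_harm_bounds(1)[of S t] by (simp add: distrib_left)
  next
    case 2
    show ?case using Cons(2) scaled_harm_bounds(2)[of S t] by (simp add: distrib_left)
  }
qed simp_all

text \<open>Termwise, \<open>p * ln (1 / p) \<le> 1 - p \<le> 1\<close>, and
  \<open>ln 2 \<ge> 2 / 3\<close> converts to bits. A bound linear in \<open>k\<close> is good
  enough because \<open>N\<close> has a factor \<open>k\<close>.\<close>

lemma shannon_entropy_bounds: "0 \<le> shannon_entropy k D" "shannon_entropy k D \<le> 3 / 2 * k"
proof -
  have b: "0 \<le> pmf D i * log 2 (1 / pmf D i) \<and> pmf D i * log 2 (1 / pmf D i) \<le> 3 / 2" for i
  proof (cases "pmf D i = 0")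
    case False
    then have p: "0 < pmf D i" "pmf D i \<le> 1" by (simp_all add: pmf_le_1 less_le)
    have "pmf D i * ln (1 / pmf D i) \<le> pmf D i * (1 / pmf D i - 1)"
      using p by (intro mult_left_mono ln_le_minus_one) auto
    also have "\<dots> \<le> 1" using p by (simp add: field_simps)
    also have "1 \<le> 3 / 2 * ln (2 :: real)" using ln2_ge_two_thirds by simp
    finally show ?thesis using p by (simp add: log_def field_simps)
  qed simp
  show "0 \<le> shannon_entropy k D" unfolding shannon_entropy_def by (intro sum_nonneg) (simp add: b)
  have "shannon_entropy k D \<le> (\<Sum>i = 1..k. 3 / 2)"
    unfolding shannon_entropy_def by (intro sum_mono) (use b in blast)
  then show "shannon_entropy k D \<le> 3 / 2 * k" by simp
qed

text \<open>\<open>X\<close> is the sum of harmonic numbers, \<open>A\<close> its fixed-point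
  version, \<open>B\<close> that of \<open>ln 2\<close>. Rounding in \<open>A\<close>, sampling, and
  the error of \<open>B\<close> contribute 8/100, 1/8 and 3/100 of
  \<open>M * S * \<epsilon>\<close>, together less than 1/2; dividing by
  \<open>M * B \<ge> M * (S / 2)\<close> leaves at most \<open>\<epsilon>\<close>.\<close>

lemma estimate_error:
  fixes X A B M S N n H k \<epsilon> :: real
  assumes X: "\<bar>X - M * (ln 2 * H)\<bar> \<le> M * \<epsilon> / 8" and A: "S * X - n \<le> A" "A \<le> S * X"
    and B: "\<bar>B - S * ln 2\<bar> \<le> 2 * N" and H: "0 \<le> H" "H \<le> 3 / 2 * k"
    and M: "M > 0" and \<epsilon>: "\<epsilon> > 0" and n: "n \<le> 8 * M * k" and N: "100 * k \<le> N * \<epsilon>" "N \<ge> 12"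
    and S: "S = N * N" and k: "0 \<le> k"
  shows "\<bar>A / (M * B) - H\<bar> \<le> \<epsilon>"
proof -
  have S0: "0 < S" "N \<le> S" "12 * N \<le> S" using S N by (auto intro: mult_mono)
  \<comment> \<open>\<open>N \<ge> 12\<close> makes \<open>2 * N\<close> at most
    \<open>S / 6\<close>, the gap between \<open>S * (2 / 3)\<close> and
    \<open>S / 2\<close>.\<close>
  have "S * (2 / 3) \<le> S * ln 2" using ln2_ge_two_thirds S0 by (intro mult_left_mono) auto
  then have B2: "S / 2 \<le> B" using B S0 by linarith
  then have MB: "0 < M * B" "M * (S / 2) \<le> M * B" using M S0 by (auto intro: mult_pos_pos)
  have "\<bar>A - M * B * H\<bar> \<le> \<bar>A - S * X\<bar> + \<bar>S * X - S * (M * (ln 2 * H))\<bar> + \<bar>M * H * (S * ln 2 - B)\<bar>"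
  proof -
    have "A - M * B * H = (A - S * X) + (S * X - S * (M * (ln 2 * H))) + M * H * (S * ln 2 - B)"
      by (simp add: algebra_simps)
    then show ?thesis by linarith
  qed
  also have "\<bar>A - S * X\<bar> \<le> M * S * \<epsilon> * (8 / 100)"
  proof -
    have "\<bar>A - S * X\<bar> \<le> 8 * M * k" using A n by linarith
    also have "\<dots> = M * (100 * k) * (8 / 100)" by simp
    also have "\<dots> \<le> M * (S * \<epsilon>) * (8 / 100)"
      using N(1) S0(2) \<epsilon> M by (intro mult_right_mono mult_left_mono order_trans[OF N(1)]) auto
    finally show ?thesis by (simp add: mult_ac)
  qed
  also have "\<bar>S * X - S * (M * (ln 2 * H))\<bar> \<le> M * S * \<epsilon> * (1 / 8)"
  proof -
    have "\<bar>S * X - S * (M * (ln 2 * H))\<bar> = S * \<bar>X - M * (ln 2 * H)\<bar>"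
      using S0 by (simp add: abs_mult flip: right_diff_distrib)
    also have "\<dots> \<le> S * (M * \<epsilon> / 8)" using X S0 by (intro mult_left_mono) auto
    finally show ?thesis by (simp add: mult_ac)
  qed
  also have "\<bar>M * H * (S * ln 2 - B)\<bar> \<le> M * S * \<epsilon> * (3 / 100)"
  proof -
    have "\<bar>M * H * (S * ln 2 - B)\<bar> = M * H * \<bar>S * ln 2 - B\<bar>" using M H by (simp add: abs_mult)
    also have "\<dots> \<le> M * (3 / 2 * k) * (2 * N)"
      using M H B k by (intro mult_mono) auto
    also have "\<dots> = M * N * (100 * k) * (3 / 100)" by simp
    also have "\<dots> \<le> M * N * (N * \<epsilon>) * (3 / 100)"
      using M N by (intro mult_right_mono mult_left_mono) auto
    finally show ?thesis by (simp add: S mult_ac)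
  qed
  finally have "\<bar>A - M * B * H\<bar> \<le> M * S * \<epsilon> * (1 / 2)"
    using mult_pos_pos[OF mult_pos_pos[OF M S0(1)] \<epsilon>] by linarith
  also have "\<dots> = \<epsilon> * (M * (S / 2))" by simp
  also have "\<dots> \<le> \<epsilon> * (M * B)" using \<epsilon> by (intro mult_left_mono MB(2)) simp
  finally have "\<bar>A - M * B * H\<bar> \<le> \<epsilon> * (M * B)" .
  moreover have "A / (M * B) - H = (A - M * B * H) / (M * B)"
    using M B2 S0 by (simp add: diff_divide_distrib)
  ultimately show ?thesis using MB by (simp add: abs_divide pos_divide_le_eq)
qed

section \<open>Sizes of the parameters and of a word\<close>

text \<open>The integer \<open>\<lfloor>log 2 k\<rfloor> + 1\<close> stands in for the logarithm in
  the program; being within a factor 2 of it, it keeps \<open>M\<close> of order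
  \<open>(log 2 k / \<epsilon>)\<^sup>2\<close>.\<close>

lemma floorlog_2_bounds:
  assumes "k \<ge> 2"
  shows "log 2 (real k) \<le> real (floorlog 2 k)" "real (floorlog 2 k) \<le> 2 * log 2 (real k)"
proof -
  have l: "1 \<le> log 2 (real k)" using assms by simp
  have "real (floorlog 2 k) = real_of_int \<lfloor>log 2 (real k)\<rfloor> + 1"
    using assms l by (simp add: floorlog_def)
  then show "log 2 (real k) \<le> real (floorlog 2 k)" "real (floorlog 2 k) \<le> 2 * log 2 (real k)"
    using l by linarith+
qed

text \<open>Origin of 49: the product is at most 36864000000 < 2 ^ 36 times
  \<open>(k * E) ^ 6\<close>. As \<open>U = k / \<epsilon> \<ge> 2\<close>, the constant is below
  \<open>U ^ 36\<close>, and \<open>k * E \<le> 2 * U \<le> U\<^sup>2\<close> contributes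
  \<open>U ^ 12\<close>; one more factor \<open>U\<close> makes the inequality strict.\<close>

lemma word_bits_sufficient:
  assumes k: "k \<ge> 2" and \<epsilon>: "0 < \<epsilon>" "\<epsilon> < 1" and E: "E = nat \<lceil>1 / \<epsilon>\<rceil>" and L: "L \<le> k"
    and N: "N = k * E * 100"
  shows "(L * E * (L * E) * 4608) * N * (N * N) * (6 * k + 2) < 2 ^ word_bits 49 k \<epsilon>"
proof -
  define U where "U = real k / \<epsilon>"
  have "real k * 1 \<le> real k * (1 / \<epsilon>)" using \<epsilon> by (intro mult_left_mono) auto
  then have U: "2 \<le> U" using k by (simp add: U_def)
  have E2: "real E \<le> 2 / \<epsilon>"
  proof -
    have "real E \<le> 1 / \<epsilon> + 1" unfolding E using \<epsilon> by simp
    also have "\<dots> \<le> 2 / \<epsilon>" using \<epsilon> by (simp add: field_simps)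
    finally show ?thesis .
  qed
  have E1: "1 \<le> E" unfolding E using \<epsilon> by (simp add: Suc_le_eq)
  have "(L * E * (L * E) * 4608) * N * (N * N) * (6 * k + 2)
      \<le> (k * E * (k * E) * 4608) * N * (N * N) * (8 * (k * E))"
  proof -
    have "k \<le> k * E" using E1 by simp
    then have "6 * k + 2 \<le> 8 * (k * E)" using k by linarith
    then show ?thesis using L by (intro mult_le_mono) auto
  qed
  also have "\<dots> = 36864000000 * (k * E) ^ 6" unfolding N by (simp add: power_numeral_reduce)
  finally have "real ((L * E * (L * E) * 4608) * N * (N * N) * (6 * k + 2)) \<le> real (36864000000 * (k * E) ^ 6)"
    by (rule of_nat_mono)
  also have "\<dots> \<le> 2 ^ 36 * (real k * real E) ^ 6" by simp
  also have "\<dots> \<le> U ^ 36 * (U\<^sup>2) ^ 6"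
  proof (intro mult_mono power_mono)
    have "real k * real E \<le> real k * (2 / \<epsilon>)" using E2 by (intro mult_left_mono) auto
    also have "\<dots> = 2 * U" by (simp add: U_def)
    also have "\<dots> \<le> U\<^sup>2" unfolding power2_eq_square using U by (intro mult_right_mono) auto
    finally show "real k * real E \<le> U\<^sup>2" .
  qed (use U in auto)
  also have "\<dots> = U ^ 48" by (simp flip: power_mult power_add)
  also have "\<dots> < U ^ 49" using U by (intro power_strict_increasing) auto
  also have "\<dots> \<le> (2 ^ nat \<lceil>log 2 U\<rceil>) ^ 49"
  proof (intro power_mono)
    have "U = 2 powr log 2 U" using U by simp
    also have "\<dots> \<le> 2 powr real (nat \<lceil>log 2 U\<rceil>)"
      by (intro powr_mono real_nat_ceiling_ge) simp
    finally show "U \<le> 2 ^ nat \<lceil>log 2 U\<rceil>" by (simp add: powr_realpow)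
  qed (use U in auto)
  also have "\<dots> = real (2 ^ word_bits 49 k \<epsilon>)"
    by (simp add: word_bits_def U_def mult.commute[of 49] power_mult)
  finally show ?thesis by (rule of_nat_less_imp_less)
qed

text \<open>Joins the execution of the program to the error estimate. All probability is confined to
  the hypotheses \<open>ts\<close> and \<open>X\<close> on the stream.\<close>

lemma entropy_prog_returns:
  assumes k: "k \<ge> 2" and \<epsilon>: "0 < \<epsilon>" "\<epsilon> < 1" and E: "E = nat \<lceil>1 / \<epsilon>\<rceil>" and L: "L = floorlog 2 k"
    and M: "M = L * E * (L * E) * 4608"
    and xs: "length xs = M * (6 * k + 2)" "set xs \<subseteq> {1..k}" and ts: "gaps M xs = Some ts"
    and X: "\<bar>sum_list (map harm ts) - M * (ln 2 * shannon_entropy k D)\<bar> \<le> M * \<epsilon> / 8"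
  shows "\<exists>h. returns 16 (word_bits 49 k \<epsilon>) entropy_prog k \<epsilon> xs bs h \<and> \<bar>h - shannon_entropy k D\<bar> \<le> \<epsilon>"
proof -
  define w where "w = word_bits 49 k \<epsilon>"
  define N where "N = k * E * 100"
  define S where "S = N * N"
  have E1: "1 \<le> E" unfolding E using \<epsilon> by (simp add: Suc_le_eq)
  have E_eps: "1 \<le> real E * \<epsilon>"
  proof -
    have "1 / \<epsilon> \<le> real E" unfolding E by (rule real_nat_ceiling_ge)
    then show ?thesis using \<epsilon> by (simp add: field_simps)
  qed
  have Lk: "L \<le> k" unfolding L by (intro floorlog_leI) simp_all
  have L1: "1 \<le> L" unfolding L using k by (simp add: floorlog_def)
  have M1: "1 \<le> M" unfolding M using L1 E1 by simp
  have bound: "M * N * S * (6 * k + 2) < 2 ^ w"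
    unfolding w_def M S_def using word_bits_sufficient[OF k \<epsilon> E Lk N_def] .
  have w0: "w > 0"
  proof (rule ccontr)
    assume "\<not> w > 0"
    then have "M * N * S * (6 * k + 2) = 0" using bound by simp
    then show False using M1 E1 k by (simp add: N_def S_def)
  qed
  have kE: "k < 2 ^ w" "E < 2 ^ w"
  proof -
    have "k * E * 1 \<le> k * E * (100 * (M * S * (6 * k + 2)))"
      using M1 E1 k by (intro mult_le_mono2) (simp add: S_def N_def Suc_le_eq)
    also have "\<dots> = M * N * S * (6 * k + 2)" by (simp only: N_def mult_ac)
    finally have "k * E < 2 ^ w" using bound by linarith
    moreover have "k \<le> k * E" "E \<le> k * E" using k E1 by simp_all
    ultimately show "k < 2 ^ w" "E < 2 ^ w" by linarith+
  qed
  have "wp 16 w entropy_prog (\<lambda>(R, ys, bs). R 0 = sum_list (map (scaled_harm S) ts) \<and> R 1 = M * ln2_sum S N)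
      (init_regs 16 w k \<epsilon>, xs, bs)"
    by (rule wp_entropy_prog[OF k E1 L N_def S_def M refl w0 bound xs ts])
      (use kE in \<open>auto simp: init_regs_def store_def simp flip: E\<close>)
  then have "returns 16 w entropy_prog k \<epsilon> xs bs
      (real (sum_list (map (scaled_harm S) ts)) / real (M * ln2_sum S N))"
    unfolding wp_def returns_def by fastforce
  moreover have "\<bar>real (sum_list (map (scaled_harm S) ts)) / (real M * real (ln2_sum S N)) - shannon_entropy k D\<bar> \<le> \<epsilon>"
  proof (rule estimate_error[OF X _ _ ln2_sum_bounds])
    have "sum_list ts \<le> M * (6 * k + 2)" using gaps_SomeD[OF ts] xs by simp
    then show "real S * sum_list (map harm ts) - real (M * (6 * k + 2)) \<le> real (sum_list (map (scaled_harm S) ts))"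
      using sum_list_scaled_harm_bounds(1)[of S ts] by linarith
    have "M * (6 * k + 2) \<le> M * (8 * k)" using k by (intro mult_le_mono2) simp
    then show "real (M * (6 * k + 2)) \<le> 8 * real M * real k"
      using of_nat_mono[of "M * (6 * k + 2)" "M * (8 * k)", where ?'a = real] by (simp add: mult_ac)
    have "100 * real k * 1 \<le> 100 * real k * (real E * \<epsilon>)" using E_eps by (intro mult_left_mono) auto
    then show "100 * real k \<le> real N * \<epsilon>" by (simp add: N_def mult_ac)
    have "1 * 1 * 100 \<le> N" unfolding N_def using k E1 by (intro mult_le_mono) auto
    then show "12 \<le> real N" "0 < N" by simp_all
  qed (rule sum_list_scaled_harm_bounds shannon_entropy_bounds |
      use M1 \<epsilon> in \<open>simp add: S_def\<close>)+
  ultimately show ?thesis unfolding w_def by auto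
qed

theorem theorem1:
  "\<exists>(P :: com) (q :: nat) (c :: nat) (C :: real) (n :: nat \<Rightarrow> real \<Rightarrow> nat) (r :: nat \<Rightarrow> real \<Rightarrow> nat).
     c > 0 \<and> C > 0 \<and>
     (\<forall>(k :: nat) (\<epsilon> :: real). k \<ge> 1 \<and> 0 < \<epsilon> \<and> \<epsilon> < 1 \<longrightarrow>
        real (n k \<epsilon>) \<le> C * (real k / \<epsilon>\<^sup>2 * (log 2 (real k))\<^sup>2 * (max 1 (log 2 (1 / \<epsilon>)))\<^sup>2) \<and>
        (\<forall>D :: nat pmf. set_pmf D \<subseteq> {1..k} \<longrightarrow>
           measure_pmf.prob
             (pair_pmf (replicate_pmf (n k \<epsilon>) D) (replicate_pmf (r k \<epsilon>) (bernoulli_pmf (1 / 2))))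
             {(xs, bs). \<exists>h. returns q (word_bits c k \<epsilon>) P k \<epsilon> xs bs h \<and>
                            \<bar>h - shannon_entropy k D\<bar> \<le> \<epsilon>}
           \<ge> 2 / 3))"
proof -
  define M where "M k \<epsilon> = floorlog 2 k * nat \<lceil>1 / \<epsilon>\<rceil> * (floorlog 2 k * nat \<lceil>1 / \<epsilon>\<rceil>) * 4608"
    for k :: nat and \<epsilon> :: real
  \<comment> \<open>For \<open>k = 1\<close> the allowed number of samples is 0, as
    \<open>log 2 1 = 0\<close>, so the program has to answer without reading. The entropy is 0 then,
    and the test \<open>1 < k\<close> sends the program to the branch that returns 0.\<close>
  define n where "n k \<epsilon> = (if k = 1 then 0 else M k \<epsilon> * (6 * k + 2))" for k \<epsilon>
  have main: "real (n k \<epsilon>) \<le> 589824 * (real k / \<epsilon>\<^sup>2 * (log 2 (real k))\<^sup>2 * (max 1 (log 2 (1 / \<epsilon>)))\<^sup>2) \<and>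
        (\<forall>D :: nat pmf. set_pmf D \<subseteq> {1..k} \<longrightarrow>
           measure_pmf.prob
             (pair_pmf (replicate_pmf (n k \<epsilon>) D) (replicate_pmf 0 (bernoulli_pmf (1 / 2))))
             {(xs, bs). \<exists>h. returns 16 (word_bits 49 k \<epsilon>) entropy_prog k \<epsilon> xs bs h \<and>
                            \<bar>h - shannon_entropy k D\<bar> \<le> \<epsilon>}
           \<ge> 2 / 3)"
    if k: "k \<ge> 1" and \<epsilon>: "0 < \<epsilon>" "\<epsilon> < 1" for k \<epsilon>
  proof (intro conjI allI impI)
    define E where "E = nat \<lceil>1 / \<epsilon>\<rceil>"
    define L where "L = floorlog 2 k"
    have M_eq: "M k \<epsilon> = L * E * (L * E) * 4608" by (simp add: M_def E_def L_def)
    have E2: "real E \<le> 2 / \<epsilon>"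
    proof -
      have "real E \<le> 1 / \<epsilon> + 1" unfolding E_def using \<epsilon> by simp
      also have "\<dots> \<le> 2 / \<epsilon>" using \<epsilon> by (simp add: field_simps)
      finally show ?thesis .
    qed
    show "real (n k \<epsilon>) \<le> 589824 * (real k / \<epsilon>\<^sup>2 * (log 2 (real k))\<^sup>2 * (max 1 (log 2 (1 / \<epsilon>)))\<^sup>2)"
    proof (cases "k = 1")
      case False
      then have k2: "k \<ge> 2" using k by simp
      have "real L * real E \<le> 2 * log 2 (real k) * (2 / \<epsilon>)"
        unfolding L_def using floorlog_2_bounds[OF k2] E2 k2 by (intro mult_mono) auto
      then have LE: "(real L * real E)\<^sup>2 \<le> (2 * log 2 (real k) * (2 / \<epsilon>))\<^sup>2"
        by (intro power_mono) auto
      have "real (n k \<epsilon>) = 4608 * (real L * real E)\<^sup>2 * (6 * real k + 2)"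
        using False by (simp add: n_def M_eq power2_eq_square algebra_simps)
      \<comment> \<open>589824 = 4608 * 16 * 8: the 16 is the square of the two factors 2 lost in
        \<open>L \<le> 2 * log 2 k\<close> and \<open>E \<le> 2 / \<epsilon>\<close>, and the 8
        comes from \<open>6 * k + 2 \<le> 8 * k\<close>.\<close>
      also have "\<dots> \<le> 4608 * (2 * log 2 (real k) * (2 / \<epsilon>))\<^sup>2 * (8 * real k)"
        using LE k2 by (intro mult_mono) auto
      also have "\<dots> = 589824 * (real k / \<epsilon>\<^sup>2 * (log 2 (real k))\<^sup>2 * 1)"
        by (simp add: power_mult_distrib power_divide)
      also have "\<dots> \<le> 589824 * (real k / \<epsilon>\<^sup>2 * (log 2 (real k))\<^sup>2 * (max 1 (log 2 (1 / \<epsilon>)))\<^sup>2)"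
        by (intro mult_left_mono) auto
      finally show ?thesis .
    qed (simp add: n_def)
    fix D :: "nat pmf" assume D: "set_pmf D \<subseteq> {1..k}"
    let ?R = "replicate_pmf (n k \<epsilon>) D"
    let ?ok = "\<lambda>xs bs. \<exists>h. returns 16 (word_bits 49 k \<epsilon>) entropy_prog k \<epsilon> xs bs h \<and>
                            \<bar>h - shannon_entropy k D\<bar> \<le> \<epsilon>"
    have "2 / 3 \<le> measure_pmf.prob ?R {xs. ?ok xs []}"
    proof (cases "k = 1")
      case True
      have "D = return_pmf 1" using D True by (simp add: set_pmf_subset_singleton)
      then have H: "shannon_entropy k D = 0" using True by (simp add: shannon_entropy_def)
      have w: "word_bits 49 k \<epsilon> > 0" using \<epsilon> True by (simp add: word_bits_def)
      have "wp 16 (word_bits 49 k \<epsilon>) entropy_prog (\<lambda>(R, ys, bs). R 0 = 0)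
          (init_regs 16 (word_bits 49 k \<epsilon>) k \<epsilon>, [], [])"
        using w True by (simp add: entropy_prog_def init_regs_def store_def)
      then have "?ok [] []" unfolding wp_def returns_def H using \<epsilon> by fastforce
      then show ?thesis using True by (simp add: n_def indicator_def)
    next
      case False
      then have k2: "k \<ge> 2" using k by simp
      let ?a = "real (M k \<epsilon>) * \<epsilon> / 8"
      let ?G = "{xs. \<exists>ts. gaps (M k \<epsilon>) xs = Some ts \<and>
        \<bar>sum_list (map harm ts) - M k \<epsilon> * (ln 2 * shannon_entropy k D)\<bar> \<le> ?a}"
      have n: "n k \<epsilon> = M k \<epsilon> * (6 * k + 2)" using False by (simp add: n_def)
      have L1: "1 \<le> L" unfolding L_def using k2 by (simp add: floorlog_def)
      have E1: "1 \<le> E" unfolding E_def using \<epsilon> by (simp add: Suc_le_eq)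
      have M0: "M k \<epsilon> > 0" using L1 E1 by (simp add: M_eq)
      have "1 / \<epsilon> \<le> real E" unfolding E_def by (rule real_nat_ceiling_ge)
      then have "log 2 (real k) * 1 \<le> real L * (real E * \<epsilon>)"
        using floorlog_2_bounds(1)[OF k2] k2 \<epsilon> unfolding L_def by (intro mult_mono) (auto simp: field_simps)
      then have "(log 2 (real k))\<^sup>2 \<le> (real L * (real E * \<epsilon>))\<^sup>2" using k2 by (intro power_mono) auto
      then have "M k \<epsilon> * (72 * (log 2 (real k))\<^sup>2) \<le> M k \<epsilon> * (72 * (real L * (real E * \<epsilon>))\<^sup>2)"
        by (intro mult_left_mono) auto
      \<comment> \<open>As 4608 = 72 * 64, the factor \<open>72 * (L * E)\<^sup>2\<close> is
        \<open>M / 64\<close>, so the deviation \<open>M * \<epsilon> / 8\<close> meets the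
        requirement exactly.\<close>
      also have "\<dots> = ?a\<^sup>2" by (simp add: M_eq power2_eq_square)
      finally have a: "72 * real (M k \<epsilon>) * (log 2 (real k))\<^sup>2 \<le> ?a\<^sup>2" by (simp add: mult_ac)
      have "2 / 3 \<le> measure_pmf.prob ?R ?G"
        by (rule prob_gaps[OF D k2 M0 _ a n]) (use M0 \<epsilon> in simp)
      \<comment> \<open>Passing to the support supplies the length of the stream and the range of
        its items.\<close>
      also have "\<dots> = measure_pmf.prob ?R (?G \<inter> set_pmf ?R)" by (simp add: measure_Int_set_pmf)
      also have "\<dots> \<le> measure_pmf.prob ?R {xs. ?ok xs []}"
      proof (intro measure_pmf.finite_measure_mono subsetI)
        fix xs assume xs: "xs \<in> ?G \<inter> set_pmf ?R"
        then obtain ts where ts: "gaps (M k \<epsilon>) xs = Some ts"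
          "\<bar>sum_list (map harm ts) - M k \<epsilon> * (ln 2 * shannon_entropy k D)\<bar> \<le> ?a" by blast
        have "length xs = M k \<epsilon> * (6 * k + 2)" "set xs \<subseteq> {1..k}"
          using xs D by (auto simp: set_replicate_pmf n)
        then have "?ok xs []"
          by (rule entropy_prog_returns[OF k2 \<epsilon> E_def L_def M_eq _ _ ts])
        then show "xs \<in> {xs. ?ok xs []}" by simp
      qed simp
      finally show ?thesis .
    qed
    \<comment> \<open>With no random bits requested, the second component is the empty list almost
      surely.\<close>
    then show "2 / 3 \<le> measure_pmf.prob
       (pair_pmf ?R (replicate_pmf 0 (bernoulli_pmf (1 / 2)))) {(xs, bs). ?ok xs bs}"
      by (simp add: pair_return_pmf2 vimage_def)
  qed
  show ?thesis
    by (rule exI[of _ entropy_prog], rule exI[of _ 16], rule exI[of _ 49], rule exI[of _ 589824],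
      rule exI[of _ n], rule exI[of _ "\<lambda>_ _. 0"]) (use main in simp)
qed

end
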